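(* Assume that the classes $A_1$ and $A_2$ (defined in the context with the choice $a_{13}=h_3$, $c$ an integer) are integral, let $L_i$ be a smooth complex line bundle on $X$ with first Chern class $A_i$, and let $\mathcal{V}_i=L_i\oplus L_i^{-1}$ for $i=1,2$. Then $$ch\bigl(\mathcal{V}_1^{\oplus c^2\Delta}\ominus \mathcal{V}_2\bigr)=4c^2\Delta\, M ,\qquad M=\mathbb{D}\,(dz_1\wedge d\bar z_2\wedge dz_3\wedge d\bar z_4+d\bar z_1\wedge dz_2\wedge d\bar z_3\wedge dz_4),$$ where the equality holds modulo (rational) 0-forms and 8-forms.
   Context: Setting. Let $P(x)=p_4x^4+p_2x^2+p_1x+p_0\in\mathbb{Q}[x]$ be irreducible with four real roots $x_1>x_2>x_3>x_4$, such that the splitting field $L_1=\mathbb{Q}(x_1,\dots,x_4)\subset\mathbb{R}$ has Galois group $S_4$. Put $L=L_1(i)$, $G=Gal(L/\mathbb{Q})\cong S_4\times\{e,\rho\}$ ($\rho$ = complex conjugation), $\mathbb{D}=\prod_{i<j}(x_i-x_j)>0$, $\Delta=\mathbb{D}^2\in\mathbb{Q}$; it is assumed (after scaling the roots if necessary) that $\Delta$ is an integer. Let $F_1=\mathbb{Q}(x_1)$ and $F=F_1(i\mathbb{D})\subset L$, a field of degree 8. Its embeddings in $\mathbb{C}$ are $\varphi_j,\varphi_{\bar j}$ ($j=1,2,3,4$), where $\varphi_j(x_1)=x_j$, $\varphi_j(i\mathbb{D})=(-1)^{j+1}i\mathbb{D}$, and $\varphi_{\bar j}$ is the complex conjugate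 of $\varphi_j$. Let $V=\mathbb{R}\otimes_{\mathbb{Q}}F$, let $\Lambda=\mathfrak{o}_F\subset V$ be the lattice given by the ring of integers, and let $z_j:V\to\mathbb{C}$ be the $\mathbb{R}$-linear extension of $\varphi_j$; $(z_1,z_2,z_3,z_4):V\to\mathbb{C}^4$ is an isomorphism of real vector spaces and makes $X=V/\Lambda$ a complex torus. Cohomology of $X$ is identified with translation-invariant forms. Let $h_2=x_1x_2+x_3x_4$, $h_3=x_1x_3+x_2x_4$, $h_4=x_1x_4+x_2x_3$, and set $h_{12}=h_{34}=h_2$, $h_{13}=h_{24}=h_3$, $h_{14}=h_{23}=h_4$. Put $e_1=dz_1$, $e_2=d\bar z_2$, $e_3=dz_3$, $e_4=d\bar z_4$ and $A_+=\sum_{1\le i<j\le 4}h_{ij}(x_i-x_j)\,e_i\wedge e_j$. Then, with $c$ an integer, $$A_1=A_++\overline{A_+},\qquad A_2=ic\mathbb{D}\,(A_+-\overline{A_+}).$$ (Equivalently, $A_1$ is the rational class whose coefficient of $dz_1\wedge dz_3$ is $a_{13}(x_1-x_3)$ with $a_{13}=h_3$ and whose other coefficients are determined by Galois covariance over the $G$-orbit of $\{1,3\}$; $A_2$ is obtained from it by replacing $a_{13}$ by $ic\mathbb{D}a_{13}$.) *)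

theory Defs
  imports
    "HOL-Analysis.Analysis"
    "HOL-Computational_Algebra.Computational_Algebra"
    "HOL-Algebra.Bij"
    "HOL-Algebra.Sym_Groups"
    "Jordan_Normal_Form.Matrix"
begin

section \<open>Number fields inside the real and complex numbers\<close>

definition adjoin :: "'a::field_char_0 set \<Rightarrow> 'a set" where
  "adjoin S = \<Inter>{K. S \<subseteq> K \<and> 0 \<in> K \<and> 1 \<in> K \<and>
     (\<forall>a\<in>K. \<forall>b\<in>K. a + b \<in> K \<and> a * b \<in> K) \<and> (\<forall>a\<in>K. - a \<in> K \<and> inverse a \<in> K)}"

definition field_hom_on :: "'a::field set \<Rightarrow> ('a \<Rightarrow> 'b::field) \<Rightarrow> bool" where
  "field_hom_on K f \<longleftrightarrow> f 1 = 1 \<and> (\<forall>a\<in>K. \<forall>b\<in>K. f (a + b) = f a + f b \<and> f (a * b) = f a * f b)"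

text \<open>The Galois group over the rationals: field automorphisms of a field of characteristic 0
  fix the prime field automatically.\<close>

definition galois_group :: "'a::field_char_0 set \<Rightarrow> ('a \<Rightarrow> 'a) monoid" where
  "galois_group K = BijGroup K \<lparr>carrier := {s \<in> Bij K. field_hom_on K s}\<rparr>"

definition ring_of_integers :: "complex set \<Rightarrow> complex set" where
  "ring_of_integers K = {a \<in> K. algebraic_int a}"

abbreviation rat_scale :: "rat \<Rightarrow> complex \<Rightarrow> complex" where
  "rat_scale q a \<equiv> of_rat q * a"

text \<open>\<open>iota\<close> exhibits the real vector space \<open>'v\<close> as \<open>\<real> \<otimes> F\<close> (tensor product over the rationals),
  with \<open>iota a = 1 \<otimes> a\<close>: it is linear over the rationals and carries each basis of \<open>F\<close> over the
  rationals to a basis of \<open>'v\<close> over the reals.\<close>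

definition real_scalar_extension :: "complex set \<Rightarrow> (complex \<Rightarrow> 'v::euclidean_space) \<Rightarrow> bool" where
  "real_scalar_extension F iota \<longleftrightarrow>
     (\<forall>a\<in>F. \<forall>b\<in>F. iota (a + b) = iota a + iota b) \<and>
     (\<forall>q. \<forall>a\<in>F. iota (rat_scale q a) = of_rat q *\<^sub>R iota a) \<and>
     (\<forall>B. B \<subseteq> F \<longrightarrow> \<not> Modules.module.dependent rat_scale B \<longrightarrow>
        Modules.module.span rat_scale B = F \<longrightarrow>
        inj_on iota B \<and> independent (iota ` B) \<and> span (iota ` B) = UNIV)"


section \<open>Exterior algebra\<close>

text \<open>An element of the exterior algebra of complex-valued real-linear forms on \<open>'v\<close> is encoded
  by its values on lists of vectors: the restriction to lists of length \<open>k\<close> is the component of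
  degree \<open>k\<close>.\<close>

type_synonym 'v form = "'v list \<Rightarrow> complex"

definition ext_form :: "'v::real_vector form \<Rightarrow> bool" where
  "ext_form a \<longleftrightarrow> (\<forall>vs. (\<forall>i<length vs. linear (\<lambda>v. a (vs[i := v]))) \<and> (\<not> distinct vs \<longrightarrow> a vs = 0))"

definition homogeneous :: "nat \<Rightarrow> 'v form \<Rightarrow> bool" where
  "homogeneous k a \<longleftrightarrow> (\<forall>vs. length vs \<noteq> k \<longrightarrow> a vs = 0)"

definition unit_form :: "'v form" where
  "unit_form vs = (if vs = [] then 1 else 0)"

definition covector :: "('v \<Rightarrow> complex) \<Rightarrow> 'v form" where
  "covector f vs = (case vs of [v] \<Rightarrow> f v | _ \<Rightarrow> 0)"

definition conj_form :: "'v form \<Rightarrow> 'v form" where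
  "conj_form a vs = cnj (a vs)"

text \<open>The wedge product is the sum over all shuffles, without factorial factors, so that
  \<open>(df \<and> dg) (u, v) = f u * g v - f v * g u\<close>. A shuffle is given by the set \<open>S\<close> of positions whose
  vectors go to the first factor; its sign counts inversions.\<close>

definition wedge :: "'v form \<Rightarrow> 'v form \<Rightarrow> 'v form" (infixr "\<and>\<^sub>w" 70) where
  "(a \<and>\<^sub>w b) vs = (\<Sum>S\<in>Pow {..<length vs}.
     (-1) ^ card {(i, j). i \<in> S \<and> j < i \<and> j \<notin> S} * a (nths vs S) * b (nths vs (- S)))"


section \<open>Smooth functions and differential forms\<close>

primrec C_times_differentiable_on :: "nat \<Rightarrow> ('v::euclidean_space \<Rightarrow> complex) \<Rightarrow> 'v set \<Rightarrow> bool" where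
  "C_times_differentiable_on 0 f S \<longleftrightarrow> continuous_on S f"
| "C_times_differentiable_on (Suc n) f S \<longleftrightarrow>
     (\<forall>x\<in>S. f differentiable (at x)) \<and>
     (\<forall>v. C_times_differentiable_on n (\<lambda>x. frechet_derivative f (at x) v) S)"

text \<open>Used for open \<open>S\<close> only.\<close>

definition smooth_on :: "('v::euclidean_space \<Rightarrow> complex) \<Rightarrow> 'v set \<Rightarrow> bool" where
  "smooth_on f S \<longleftrightarrow> (\<forall>n. C_times_differentiable_on n f S)"

text \<open>Functions and differential forms on the torus \<open>V/\<Lambda>\<close> are the \<open>\<Lambda>\<close>-periodic ones on \<open>V\<close>; open
  subsets of the torus are the \<open>\<Lambda>\<close>-invariant open subsets of \<open>V\<close>.\<close>

definition torus_open :: "'v::euclidean_space set \<Rightarrow> 'v set \<Rightarrow> bool" where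
  "torus_open \<Lambda> U \<longleftrightarrow> open U \<and> (\<forall>x. \<forall>l\<in>\<Lambda>. x + l \<in> U \<longleftrightarrow> x \<in> U)"

definition torus_smooth :: "'v::euclidean_space set \<Rightarrow> 'v set \<Rightarrow> ('v \<Rightarrow> complex) \<Rightarrow> bool" where
  "torus_smooth \<Lambda> U f \<longleftrightarrow> smooth_on f U \<and> (\<forall>x\<in>U. \<forall>l\<in>\<Lambda>. f (x + l) = f x)"

definition torus_diff_form :: "'v::euclidean_space set \<Rightarrow> 'v set \<Rightarrow> ('v \<Rightarrow> 'v form) \<Rightarrow> bool" where
  "torus_diff_form \<Lambda> U w \<longleftrightarrow>
     (\<forall>x\<in>U. ext_form (w x)) \<and> (\<forall>vs. torus_smooth \<Lambda> U (\<lambda>x. w x vs))"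

definition ext_deriv :: "('v::euclidean_space \<Rightarrow> 'v form) \<Rightarrow> 'v \<Rightarrow> 'v form" where
  "ext_deriv w x vs = (\<Sum>i<length vs. (-1) ^ i *
     frechet_derivative (\<lambda>y. w y (take i vs @ drop (Suc i) vs)) (at x) (vs ! i))"


section \<open>Smooth complex vector bundles on a torus\<close>

text \<open>A vector bundle is given by trivialisations over an open cover, with transition functions
  \<open>transition p q\<close> turning coordinates over \<open>chart q\<close> into coordinates over \<open>chart p\<close>. The cover is
  indexed by the points of \<open>V\<close>, with \<open>p \<in> chart p\<close>; this is no restriction, since every bundle is
  trivial near each point.\<close>

record 'v vbundle =
  vb_rank :: nat
  chart :: "'v \<Rightarrow> 'v set"
  transition :: "'v \<Rightarrow> 'v \<Rightarrow> 'v \<Rightarrow> complex mat"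

definition vector_bundle :: "'v::euclidean_space set \<Rightarrow> 'v vbundle \<Rightarrow> bool" where
  "vector_bundle \<Lambda> E \<longleftrightarrow>
     (\<forall>p. p \<in> chart E p \<and> torus_open \<Lambda> (chart E p)) \<and>
     (\<forall>p q. \<forall>x \<in> chart E p \<inter> chart E q. transition E p q x \<in> carrier_mat (vb_rank E) (vb_rank E)) \<and>
     (\<forall>p q. \<forall>i<vb_rank E. \<forall>j<vb_rank E.
        torus_smooth \<Lambda> (chart E p \<inter> chart E q) (\<lambda>x. transition E p q x $$ (i, j))) \<and>
     (\<forall>p. \<forall>x \<in> chart E p. transition E p p x = 1\<^sub>m (vb_rank E)) \<and>
     (\<forall>p q s. \<forall>x \<in> chart E p \<inter> chart E q \<inter> chart E s.
        transition E p q x * transition E q s x = transition E p s x)"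

definition line_bundle :: "'v::euclidean_space set \<Rightarrow> 'v vbundle \<Rightarrow> bool" where
  "line_bundle \<Lambda> L \<longleftrightarrow> vector_bundle \<Lambda> L \<and> vb_rank L = 1"

text \<open>The dual bundle; for a line bundle \<open>L\<close> this is \<open>L\<close> to the power -1. By the cocycle condition
  \<open>transition E q p x\<close> is the inverse matrix of \<open>transition E p q x\<close>.\<close>

definition dual_bundle :: "'v vbundle \<Rightarrow> 'v vbundle" where
  "dual_bundle E = \<lparr>vb_rank = vb_rank E, chart = chart E, transition = (\<lambda>p q x. (transition E q p x)\<^sup>T)\<rparr>"

definition direct_sum :: "'v vbundle \<Rightarrow> 'v vbundle \<Rightarrow> 'v vbundle" where
  "direct_sum E F = \<lparr>vb_rank = vb_rank E + vb_rank F, chart = (\<lambda>p. chart E p \<inter> chart F p),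
     transition = (\<lambda>p q x. four_block_mat (transition E p q x) (0\<^sub>m (vb_rank E) (vb_rank F))
                                     (0\<^sub>m (vb_rank F) (vb_rank E)) (transition F p q x))\<rparr>"

primrec sum_power :: "nat \<Rightarrow> 'v vbundle \<Rightarrow> 'v vbundle" where
  "sum_power 0 E = \<lparr>vb_rank = 0, chart = (\<lambda>p. UNIV), transition = (\<lambda>p q x. 1\<^sub>m 0)\<rparr>"
| "sum_power (Suc n) E = direct_sum E (sum_power n E)"


section \<open>Chern classes and the Chern character (Chern--Weil theory)\<close>

text \<open>Matrices of forms are indexed by \<open>{..<r} \<times> {..<r}\<close>; entries outside this range are ignored.\<close>

type_synonym 'v form_matrix = "nat \<Rightarrow> nat \<Rightarrow> 'v form"

primrec fm_power :: "nat \<Rightarrow> 'v form_matrix \<Rightarrow> nat \<Rightarrow> 'v form_matrix" where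
  "fm_power r W 0 = (\<lambda>a b. if a = b then unit_form else (\<lambda>vs. 0))"
| "fm_power r W (Suc k) = (\<lambda>a b vs. \<Sum>c<r. (W a c \<and>\<^sub>w fm_power r W k c b) vs)"

text \<open>A connection is \<open>d + \<theta> p\<close> over \<open>chart p\<close>. The last conjunct says that the local expressions
  agree on overlaps: \<open>g * \<theta> q = \<theta> p * g + dg\<close> for \<open>g = transition p q\<close>.\<close>

definition connection ::
  "'v::euclidean_space set \<Rightarrow> 'v vbundle \<Rightarrow> ('v \<Rightarrow> 'v \<Rightarrow> 'v form_matrix) \<Rightarrow> bool" where
  "connection \<Lambda> E \<theta> \<longleftrightarrow>
     (\<forall>p. \<forall>a<vb_rank E. \<forall>b<vb_rank E. torus_diff_form \<Lambda> (chart E p) (\<lambda>x. \<theta> p x a b) \<and>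
        (\<forall>x \<in> chart E p. homogeneous 1 (\<theta> p x a b))) \<and>
     (\<forall>p q. \<forall>x \<in> chart E p \<inter> chart E q. \<forall>a<vb_rank E. \<forall>b<vb_rank E. \<forall>v.
        (\<Sum>c<vb_rank E. transition E p q x $$ (a, c) * \<theta> q x c b [v]) =
        (\<Sum>c<vb_rank E. \<theta> p x a c [v] * transition E p q x $$ (c, b)) +
        frechet_derivative (\<lambda>y. transition E p q y $$ (a, b)) (at x) v)"

definition curvature :: "nat \<Rightarrow> ('v::euclidean_space \<Rightarrow> 'v form_matrix) \<Rightarrow> 'v \<Rightarrow> 'v form_matrix" where
  "curvature r th x a b vs =
     ext_deriv (\<lambda>y. th y a b) x vs + (\<Sum>c<r. (th x a c \<and>\<^sub>w th x c b) vs)"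

text \<open>The trace of \<open>\<i>/(2\<pi>)\<close> times the curvature, and the trace of its exponential. The exponential
  series may be cut off because forms of degree above the dimension vanish.\<close>

definition first_chern_form :: "nat \<Rightarrow> 'v::euclidean_space form_matrix \<Rightarrow> 'v form" where
  "first_chern_form r W vs = \<i> / (2 * of_real pi) * (\<Sum>a<r. W a a vs)"

definition chern_character_form :: "nat \<Rightarrow> 'v::euclidean_space form_matrix \<Rightarrow> 'v form" where
  "chern_character_form r W vs =
     (\<Sum>k\<le>DIM('v). (\<i> / (2 * of_real pi)) ^ k / fact k * (\<Sum>a<r. fm_power r W k a a vs))"

text \<open>The form on the torus given locally by \<open>w p\<close> on \<open>chart p\<close> represents the de Rham class of the
  translation-invariant form \<open>\<alpha>\<close>.\<close>

definition represents ::
  "'v::euclidean_space set \<Rightarrow> ('v \<Rightarrow> 'v set) \<Rightarrow> ('v \<Rightarrow> 'v \<Rightarrow> 'v form) \<Rightarrow> 'v form \<Rightarrow> bool" where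
  "represents \<Lambda> U w \<alpha> \<longleftrightarrow> ext_form \<alpha> \<and>
     (\<exists>\<eta>. torus_diff_form \<Lambda> UNIV \<eta> \<and>
        (\<forall>p. \<forall>x \<in> U p. \<forall>vs. w p x vs = \<alpha> vs + ext_deriv \<eta> x vs))"

text \<open>Characteristic classes are computed from a connection; by Chern--Weil theory the choice of
  the connection does not matter.\<close>

definition has_first_chern_class :: "'v::euclidean_space set \<Rightarrow> 'v vbundle \<Rightarrow> 'v form \<Rightarrow> bool" where
  "has_first_chern_class \<Lambda> E \<alpha> \<longleftrightarrow> (\<exists>\<theta>. connection \<Lambda> E \<theta> \<and>
     represents \<Lambda> (chart E) (\<lambda>p x. first_chern_form (vb_rank E) (curvature (vb_rank E) (\<theta> p) x)) \<alpha>)"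

definition has_chern_character :: "'v::euclidean_space set \<Rightarrow> 'v vbundle \<Rightarrow> 'v form \<Rightarrow> bool" where
  "has_chern_character \<Lambda> E \<alpha> \<longleftrightarrow> (\<exists>\<theta>. connection \<Lambda> E \<theta> \<and>
     represents \<Lambda> (chart E) (\<lambda>p x. chern_character_form (vb_rank E) (curvature (vb_rank E) (\<theta> p) x)) \<alpha>)"

text \<open>The Chern character of the virtual bundle \<open>E \<ominus> F\<close>, extended additively.\<close>

definition has_chern_character_diff ::
  "'v::euclidean_space set \<Rightarrow> 'v vbundle \<Rightarrow> 'v vbundle \<Rightarrow> 'v form \<Rightarrow> bool" where
  "has_chern_character_diff \<Lambda> E F \<alpha> \<longleftrightarrow> vector_bundle \<Lambda> E \<and> vector_bundle \<Lambda> F \<and>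
     (\<exists>a b. has_chern_character \<Lambda> E a \<and> has_chern_character \<Lambda> F b \<and> (\<forall>vs. \<alpha> vs = a vs - b vs))"

text \<open>Integral and rational cohomology of the torus: invariant forms with integral, respectively
  rational, values on the lattice.\<close>

definition integral_class :: "'v::real_vector set \<Rightarrow> 'v form \<Rightarrow> bool" where
  "integral_class \<Lambda> a \<longleftrightarrow> ext_form a \<and> (\<forall>vs. set vs \<subseteq> \<Lambda> \<longrightarrow> a vs \<in> \<int>)"

definition rational_class :: "'v::real_vector set \<Rightarrow> 'v form \<Rightarrow> bool" where
  "rational_class \<Lambda> a \<longleftrightarrow> ext_form a \<and> (\<forall>vs. set vs \<subseteq> \<Lambda> \<longrightarrow> a vs \<in> \<rat>)"


section \<open>The classes attached to the roots\<close>

text \<open>Roots \<open>x\<close> and coordinates \<open>z\<close> are indexed by 1, ..., 4.\<close>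

definition root_disc :: "(nat \<Rightarrow> real) \<Rightarrow> real" where
  "root_disc x = (\<Prod>j=1..4. \<Prod>i=1..<j. x i - x j)"

definition h_coeff :: "(nat \<Rightarrow> real) \<Rightarrow> nat \<Rightarrow> nat \<Rightarrow> real" where
  "h_coeff x i j =
     (if (i, j) \<in> {(1, 2), (3, 4)} then x 1 * x 2 + x 3 * x 4
      else if (i, j) \<in> {(1, 3), (2, 4)} then x 1 * x 3 + x 2 * x 4
      else x 1 * x 4 + x 2 * x 3)"

definition dz :: "(nat \<Rightarrow> 'v \<Rightarrow> complex) \<Rightarrow> nat \<Rightarrow> 'v form" where
  "dz z j = covector (z j)"

definition dzbar :: "(nat \<Rightarrow> 'v \<Rightarrow> complex) \<Rightarrow> nat \<Rightarrow> 'v form" where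
  "dzbar z j = conj_form (dz z j)"

definition e_form :: "(nat \<Rightarrow> 'v \<Rightarrow> complex) \<Rightarrow> nat \<Rightarrow> 'v form" where
  "e_form z j = (if odd j then dz z j else dzbar z j)"

definition A_plus :: "(nat \<Rightarrow> real) \<Rightarrow> (nat \<Rightarrow> 'v \<Rightarrow> complex) \<Rightarrow> 'v form" where
  "A_plus x z vs = (\<Sum>j=1..4. \<Sum>i=1..<j.
     of_real (h_coeff x i j * (x i - x j)) * (e_form z i \<and>\<^sub>w e_form z j) vs)"

definition A_one :: "(nat \<Rightarrow> real) \<Rightarrow> (nat \<Rightarrow> 'v \<Rightarrow> complex) \<Rightarrow> 'v form" where
  "A_one x z vs = A_plus x z vs + conj_form (A_plus x z) vs"

definition A_two :: "(nat \<Rightarrow> real) \<Rightarrow> (nat \<Rightarrow> 'v \<Rightarrow> complex) \<Rightarrow> int \<Rightarrow> 'v form" where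
  "A_two x z c vs =
     \<i> * of_int c * of_real (root_disc x) * (A_plus x z vs - conj_form (A_plus x z) vs)"

definition M_form :: "(nat \<Rightarrow> real) \<Rightarrow> (nat \<Rightarrow> 'v \<Rightarrow> complex) \<Rightarrow> 'v form" where
  "M_form x z vs = of_real (root_disc x) *
     ((dz z 1 \<and>\<^sub>w dzbar z 2 \<and>\<^sub>w dz z 3 \<and>\<^sub>w dzbar z 4) vs +
      (dzbar z 1 \<and>\<^sub>w dz z 2 \<and>\<^sub>w dzbar z 3 \<and>\<^sub>w dz z 4) vs)"

end

theory Submission
  imports Defs
begin

text \<open>
For a line bundle \<open>L\<close> with first Chern class \<open>A\<close> the Chern character of \<open>L \<oplus> L\<^sup>-\<^sup>1\<close> is
\<open>exp A + exp (- A)\<close>. The odd powers cancel, and the forms in question come from the eight real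
coordinates of \<open>z\<close>, so powers beyond the fourth vanish and \<open>2 + A\<^sup>2 + A\<^sup>4/12\<close> remains. In degree 0
this is an integer. In degree 8 it is rational on the lattice, because wedge powers of integral
forms are integral. The content is the identity in degree 4 (\<open>A_squares_difference\<close>).

Write \<open>P\<close> for \<open>A\<^sub>+\<close>, \<open>Q\<close> for its conjugate and \<open>k = \<i> c D\<close>. Then \<open>A\<^sub>1 = P + Q\<close>, \<open>A\<^sub>2 = k (P - Q)\<close>
and \<open>k\<^sup>2 = - c\<^sup>2 \<Delta>\<close>; this sign makes the mixed products \<open>P \<and> Q\<close> cancel in \<open>c\<^sup>2 \<Delta> A\<^sub>1\<^sup>2 - A\<^sub>2\<^sup>2\<close>, which
equals \<open>2 c\<^sup>2 \<Delta> (P\<^sup>2 + Q\<^sup>2)\<close>. Since \<open>P\<close> is a two-form in the four covectors \<open>e\<^sub>1, \<dots>, e\<^sub>4\<close>, its square is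
twice the Pfaffian of its coefficients times \<open>e\<^sub>1 \<and> e\<^sub>2 \<and> e\<^sub>3 \<and> e\<^sub>4\<close>. The root differences multiply to
differences of the cubic resolvents, \<open>(x\<^sub>1 - x\<^sub>2) (x\<^sub>3 - x\<^sub>4) = h\<^sub>3 - h\<^sub>4\<close> and so on, so the Pfaffian is
\<open>h\<^sub>2\<^sup>2 (h\<^sub>3 - h\<^sub>4) - h\<^sub>3\<^sup>2 (h\<^sub>2 - h\<^sub>4) + h\<^sub>4\<^sup>2 (h\<^sub>2 - h\<^sub>3)\<close>. That is the Vandermonde product of the resolvents,
which factors into all six root differences: it is \<open>D\<close> (\<open>vandermonde_of_resolvents\<close>).

On the side of Chern--Weil theory everything can be made to hold for forms and not only for classes.
If the first Chern form of a connection on \<open>L\<close> differs from the invariant form \<open>A\<close> by \<open>d\<eta>\<close>, a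
multiple of \<open>\<eta>\<close> added to the connection removes the difference (\<open>invariant_first_chern_form\<close>). The
curvature is then an invariant form, the dual bundle has its negative, and block-diagonal
connections make the Chern character form additive on direct sums
(\<open>invariant_chern_character_direct_sum\<close>). No exact terms ever have to be multiplied.

The wedge product is a sum over shuffles. Associativity, the alternating property and the commutation
of covectors all follow from one recursion on the list of arguments, the product rule for contraction
with the first vector (\<open>wedge_Cons\<close>).
\<close>

section \<open>The wedge product\<close>

definition contract :: "'v \<Rightarrow> 'v form \<Rightarrow> 'v form" where
  "contract v a vs = a (v # vs)"

definition grade_sign :: "'v form \<Rightarrow> 'v form" where
  "grade_sign a vs = (-1) ^ length vs * a vs"

lemma contract_grade_sign: "contract v (grade_sign a) = (\<lambda>vs. - grade_sign (contract v a) vs)"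
  by (simp add: fun_eq_iff contract_def grade_sign_def)

lemma wedge_Nil [simp]: "(a \<and>\<^sub>w b) [] = a [] * b []"
  by (simp add: wedge_def)

text \<open>A shuffle either sends the first vector to the left factor, adding no inversion, or to the right
  factor, where it is overtaken by every vector going left. Hence contraction with a vector is a graded
  derivation.\<close>

lemma wedge_Cons:
  "(a \<and>\<^sub>w b) (v # vs) = (contract v a \<and>\<^sub>w b) vs + (grade_sign a \<and>\<^sub>w contract v b) vs"
proof -
  define invs where "invs S = {(i, j). i \<in> S \<and> j < i \<and> j \<notin> S}" for S :: "nat set"
  define t where "t S = (-1) ^ card (invs S) * a (nths (v # vs) S) * b (nths (v # vs) (- S))" for S
  let ?P = "Pow {..<length vs}"
  have fin: "finite S" if "S \<in> ?P" for S
    using that finite_subset by auto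
  have fin_invs: "finite (invs S)" if "finite S" for S
  proof (rule finite_subset)
    show "invs S \<subseteq> (SIGMA i:S. {..<i})" by (auto simp: invs_def)
  qed (use that in simp)
  have inj: "inj_on (\<lambda>S. insert 0 (Suc ` S)) ?P" "inj_on (image Suc) ?P"
    by (auto simp: inj_on_def)
  have pow: "Pow {..<length (v # vs)} = (\<lambda>S. insert 0 (Suc ` S)) ` ?P \<union> image Suc ` ?P"
  proof -
    have "S \<in> (\<lambda>S. insert 0 (Suc ` S)) ` ?P \<union> image Suc ` ?P" if S: "S \<subseteq> {..<Suc (length vs)}" for S
    proof -
      define T where "T = {i. Suc i \<in> S}"
      have T: "T \<in> ?P" using S by (auto simp: T_def)
      have *: "i \<in> S \<longleftrightarrow> i = 0 \<and> 0 \<in> S \<or> (\<exists>j\<in>T. i = Suc j)" for i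
        by (cases i) (auto simp: T_def)
      show ?thesis
      proof (cases "0 \<in> S")
        case True
        then have "S = insert 0 (Suc ` T)" using * by blast
        then show ?thesis using T by blast
      next
        case False
        then have "S = Suc ` T" using * by blast
        then show ?thesis using T by blast
      qed
    qed
    then have "Pow {..<Suc (length vs)} \<subseteq> (\<lambda>S. insert 0 (Suc ` S)) ` ?P \<union> image Suc ` ?P"
      by blast
    moreover have "insert 0 (Suc ` S) \<subseteq> {..<Suc (length vs)}" if "S \<in> ?P" for S
      using that by auto
    ultimately show ?thesis by auto
  qed
  have disj: "(\<lambda>S. insert 0 (Suc ` S)) ` ?P \<inter> image Suc ` ?P = {}"
    by auto
  have card_shift: "card (map_prod Suc Suc ` A) = card A" for A :: "(nat \<times> nat) set"
    by (rule card_image) (auto simp: inj_on_def)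
  have inv0: "card (invs (insert 0 (Suc ` S))) = card (invs S)" for S
  proof -
    have "invs (insert 0 (Suc ` S)) = map_prod Suc Suc ` invs S"
    proof (intro Set.set_eqI iffI)
      fix p assume "p \<in> invs (insert 0 (Suc ` S))"
      then obtain i j where p: "p = (i, j)" and ij: "i \<in> insert 0 (Suc ` S)" "j < i" "j \<notin> insert 0 (Suc ` S)"
        by (auto simp: invs_def)
      then obtain i' where i': "i = Suc i'" "i' \<in> S" by auto
      obtain j' where j': "j = Suc j'" using ij by (cases j) auto
      show "p \<in> map_prod Suc Suc ` invs S"
        using p ij i' j' by (intro image_eqI[of _ _ "(i', j')"]) (auto simp: invs_def)
    qed (auto simp: invs_def)
    then show ?thesis
      by (simp add: card_shift)
  qed
  have inv1: "card (invs (Suc ` S)) = card S + card (invs S)" if "finite S" for S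
  proof -
    have "invs (Suc ` S) = (\<lambda>i. (Suc i, 0)) ` S \<union> map_prod Suc Suc ` invs S"
    proof (intro Set.set_eqI iffI)
      fix p assume "p \<in> invs (Suc ` S)"
      then obtain i j where p: "p = (Suc i, j)" and ij: "i \<in> S" "j < Suc i" "j \<notin> Suc ` S"
        by (auto simp: invs_def)
      show "p \<in> (\<lambda>i. (Suc i, 0)) ` S \<union> map_prod Suc Suc ` invs S"
      proof (cases j)
        case (Suc j')
        then have "p \<in> map_prod Suc Suc ` invs S"
          using p ij by (intro image_eqI[of _ _ "(i, j')"]) (auto simp: invs_def)
        then show ?thesis ..
      qed (use p ij in auto)
    qed (auto simp: invs_def)
    moreover have "(\<lambda>i. (Suc i, 0::nat)) ` S \<inter> map_prod Suc Suc ` invs S = {}"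
      by auto
    ultimately show ?thesis
      using that fin_invs by (simp add: card_Un_disjoint card_shift card_image inj_on_def)
  qed
  have len: "length (nths vs S) = card S" if "S \<in> ?P" for S
  proof -
    have "{i. i < length vs \<and> i \<in> S} = S" using that by auto
    then show ?thesis by (simp add: length_nths)
  qed
  have "(a \<and>\<^sub>w b) (v # vs) = sum t (Pow {..<length (v # vs)})"
    by (simp add: wedge_def t_def invs_def)
  also have "\<dots> = (\<Sum>S\<in>?P. t (insert 0 (Suc ` S))) + (\<Sum>S\<in>?P. t (Suc ` S))"
    unfolding pow by (subst sum.union_disjoint) (auto simp: disj sum.reindex inj o_def)
  also have "(\<Sum>S\<in>?P. t (insert 0 (Suc ` S))) = (contract v a \<and>\<^sub>w b) vs"
    unfolding wedge_def
  proof (rule sum.cong[OF refl])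
    fix S
    have "{j. Suc j \<in> insert 0 (Suc ` S)} = S" "{j. Suc j \<in> - insert 0 (Suc ` S)} = - S" by auto
    then show "t (insert 0 (Suc ` S)) = (-1) ^ card {(i, j). i \<in> S \<and> j < i \<and> j \<notin> S} *
        contract v a (nths vs S) * b (nths vs (- S))"
      by (simp add: t_def inv0 nths_Cons contract_def flip: invs_def)
  qed
  also have "(\<Sum>S\<in>?P. t (Suc ` S)) = (grade_sign a \<and>\<^sub>w contract v b) vs"
    unfolding wedge_def
  proof (rule sum.cong[OF refl])
    fix S assume S: "S \<in> ?P"
    have "{j. Suc j \<in> Suc ` S} = S" "{j. Suc j \<in> - Suc ` S} = - S" by auto
    then show "t (Suc ` S) = (-1) ^ card {(i, j). i \<in> S \<and> j < i \<and> j \<notin> S} *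
        grade_sign a (nths vs S) * contract v b (nths vs (- S))"
      using fin[OF S]
      by (simp add: t_def inv1 nths_Cons contract_def grade_sign_def len[OF S] power_add flip: invs_def)
  qed
  finally show ?thesis .
qed

lemma wedge_add_left: "((\<lambda>vs. a vs + a' vs) \<and>\<^sub>w b) = (\<lambda>vs. (a \<and>\<^sub>w b) vs + (a' \<and>\<^sub>w b) vs)"
  by (simp add: fun_eq_iff wedge_def algebra_simps sum.distrib)

lemma wedge_add_right: "(a \<and>\<^sub>w (\<lambda>vs. b vs + b' vs)) = (\<lambda>vs. (a \<and>\<^sub>w b) vs + (a \<and>\<^sub>w b') vs)"
  by (simp add: fun_eq_iff wedge_def algebra_simps sum.distrib)

lemma wedge_scale_left: "((\<lambda>vs. k * a vs) \<and>\<^sub>w b) = (\<lambda>vs. k * (a \<and>\<^sub>w b) vs)"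
  by (simp add: fun_eq_iff wedge_def sum_distrib_left mult_ac)

lemma wedge_scale_right: "(a \<and>\<^sub>w (\<lambda>vs. k * b vs)) = (\<lambda>vs. k * (a \<and>\<^sub>w b) vs)"
  by (simp add: fun_eq_iff wedge_def sum_distrib_left mult_ac)

lemma wedge_zero_left [simp]: "((\<lambda>vs. 0) \<and>\<^sub>w b) = (\<lambda>vs. 0)"
  by (simp add: fun_eq_iff wedge_def)

lemma wedge_zero_right [simp]: "(a \<and>\<^sub>w (\<lambda>vs. 0)) = (\<lambda>vs. 0)"
  by (simp add: fun_eq_iff wedge_def)

lemma conj_wedge: "conj_form (a \<and>\<^sub>w b) = conj_form a \<and>\<^sub>w conj_form b"
  by (simp add: fun_eq_iff wedge_def conj_form_def)

lemma contract_unit_form [simp]: "contract v unit_form = (\<lambda>vs. 0)"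
  by (simp add: fun_eq_iff contract_def unit_form_def)

lemma wedge_unit_right [simp]: "a \<and>\<^sub>w unit_form = a"
proof
  show "(a \<and>\<^sub>w unit_form) vs = a vs" for vs
    by (induction vs arbitrary: a) (simp_all add: wedge_Cons contract_def unit_form_def)
qed

lemma contract_wedge:
  "contract v (a \<and>\<^sub>w b) = (\<lambda>vs. (contract v a \<and>\<^sub>w b) vs + (grade_sign a \<and>\<^sub>w contract v b) vs)"
  by (simp add: fun_eq_iff contract_def wedge_Cons)

lemma wedge_unit_left [simp]: "unit_form \<and>\<^sub>w a = a"
proof -
  have sign: "grade_sign unit_form = unit_form"
    by (simp add: fun_eq_iff grade_sign_def unit_form_def)
  have "(unit_form \<and>\<^sub>w a) vs = a vs" for vs
  proof (induction vs arbitrary: a)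
    case Nil
    show ?case by (simp add: unit_form_def)
  next
    case (Cons v vs)
    then show ?case by (simp add: wedge_Cons sign contract_def)
  qed
  then show ?thesis by (simp add: fun_eq_iff)
qed

lemma length_nths_compl: "length (nths vs S) + length (nths vs (- S)) = length vs"
proof -
  have "card {i. i < length vs \<and> i \<in> S} + card {i. i < length vs \<and> i \<in> - S} =
      card ({i. i < length vs \<and> i \<in> S} \<union> {i. i < length vs \<and> i \<in> - S})"
    by (rule card_Un_disjoint[symmetric]) auto
  also have "{i. i < length vs \<and> i \<in> S} \<union> {i. i < length vs \<and> i \<in> - S} = {..<length vs}"
    by auto
  finally show ?thesis by (simp add: length_nths)
qed

lemma homogeneous_wedge:
  fixes a b :: "'v form"
  assumes "homogeneous m a" "homogeneous n b"
  shows "homogeneous (m + n) (a \<and>\<^sub>w b)"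
  unfolding homogeneous_def
proof (intro allI impI)
  fix vs :: "'v list" assume len: "length vs \<noteq> m + n"
  have "a (nths vs S) * b (nths vs (- S)) = 0" for S
    using length_nths_compl[of vs S] len assms unfolding homogeneous_def
    by (cases "length (nths vs S) = m") auto
  then show "(a \<and>\<^sub>w b) vs = 0" unfolding wedge_def mult.assoc by (simp only: mult_zero_right sum.neutral_const)
qed

lemma grade_sign_wedge: "grade_sign (a \<and>\<^sub>w b) = grade_sign a \<and>\<^sub>w grade_sign b" for a b :: "'v form"
proof
  fix vs :: "'v list"
  have sign: "(-1) ^ length vs = (-1) ^ length (nths vs S) * (-1 :: complex) ^ length (nths vs (- S))" for S
    by (simp add: length_nths_compl flip: power_add)
  show "grade_sign (a \<and>\<^sub>w b) vs = (grade_sign a \<and>\<^sub>w grade_sign b) vs"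
    unfolding grade_sign_def wedge_def sum_distrib_left
  proof (rule sum.cong[OF refl])
    show "(-1) ^ length vs * ((-1) ^ card {(i, j). i \<in> S \<and> j < i \<and> j \<notin> S} *
          a (nths vs S) * b (nths vs (- S))) =
        (-1) ^ card {(i, j). i \<in> S \<and> j < i \<and> j \<notin> S} *
          ((-1) ^ length (nths vs S) * a (nths vs S)) *
          ((-1) ^ length (nths vs (- S)) * b (nths vs (- S)))" for S
      by (simp add: sign[of S] mult_ac)
  qed
qed

lemma wedge_assoc: "(a \<and>\<^sub>w b) \<and>\<^sub>w c = a \<and>\<^sub>w b \<and>\<^sub>w c"
proof
  show "((a \<and>\<^sub>w b) \<and>\<^sub>w c) vs = (a \<and>\<^sub>w b \<and>\<^sub>w c) vs" for vs
  proof (induction vs arbitrary: a b c)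
    case (Cons v vs)
    then show ?case
      by (simp add: wedge_Cons[of "a \<and>\<^sub>w b" c] wedge_Cons[of a "b \<and>\<^sub>w c"] contract_wedge grade_sign_wedge
        wedge_add_left wedge_add_right)
  qed simp
qed

text \<open>Laplace expansion along the first factor of degree one.\<close>

lemma wedge_degree_one_Cons:
  assumes "homogeneous 1 a"
  shows "(a \<and>\<^sub>w b) (v # vs) = a [v] * b vs - (a \<and>\<^sub>w contract v b) vs"
proof -
  have "contract v a = (\<lambda>vs. a [v] * unit_form vs)"
    using assms by (auto simp: fun_eq_iff contract_def unit_form_def homogeneous_def)
  moreover have "grade_sign a = (\<lambda>vs. - 1 * a vs)"
  proof
    show "grade_sign a vs = - 1 * a vs" for vs
      using assms by (cases "length vs = 1") (auto simp: grade_sign_def homogeneous_def)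
  qed
  ultimately show ?thesis
    by (simp only: wedge_Cons wedge_scale_left wedge_unit_left) simp
qed

lemma wedge_degree_one_commute:
  assumes "homogeneous 1 a" "homogeneous 1 b"
  shows "a \<and>\<^sub>w b = (\<lambda>vs. - (b \<and>\<^sub>w a) vs)"
proof
  fix vs
  show "(a \<and>\<^sub>w b) vs = - (b \<and>\<^sub>w a) vs"
  proof (cases "length vs = 2")
    case True
    then obtain u v where "vs = [u, v]" by (auto simp: length_Suc_conv numeral_2_eq_2)
    then show ?thesis using assms
      by (simp add: wedge_degree_one_Cons contract_def homogeneous_def)
  next
    case False
    then show ?thesis using homogeneous_wedge[OF assms] homogeneous_wedge[OF assms(2,1)]
      by (simp add: homogeneous_def)
  qed
qed

lemma wedge_square_degree_one:
  assumes "homogeneous 1 a"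
  shows "a \<and>\<^sub>w a = (\<lambda>vs. 0)"
proof
  fix vs
  show "(a \<and>\<^sub>w a) vs = 0"
  proof (cases "length vs = 2")
    case True
    then obtain u v where "vs = [u, v]" by (auto simp: length_Suc_conv numeral_2_eq_2)
    then show ?thesis using assms
      by (simp add: wedge_Cons contract_def grade_sign_def homogeneous_def)
  next
    case False
    then show ?thesis using homogeneous_wedge[OF assms assms] by (simp add: homogeneous_def)
  qed
qed

section \<open>Alternating forms, integrality and vanishing\<close>

lemma ext_form_contract:
  fixes a :: "'v::real_vector form"
  assumes "ext_form a" shows "ext_form (contract v a)"
  unfolding ext_form_def contract_def
proof (intro allI conjI impI)
  fix vs :: "'v list" and i assume "i < length vs"
  then have "linear (\<lambda>u. a ((v # vs)[Suc i := u]))"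
    using assms by (auto simp: ext_form_def simp del: list_update.simps)
  then show "linear (\<lambda>u. a (v # vs[i := u]))" by simp
next
  fix vs :: "'v list" assume "\<not> distinct vs"
  then show "a (v # vs) = 0" using assms by (auto simp: ext_form_def)
qed

lemma linear_const_times: "linear f \<Longrightarrow> linear (\<lambda>v. k * f v)" for f :: "'a::real_vector \<Rightarrow> complex"
  by (auto intro!: linearI simp: linear_add linear_scale algebra_simps)

lemma ext_form_scale: "ext_form a \<Longrightarrow> ext_form (\<lambda>vs. k * a vs)"
  unfolding ext_form_def by (auto intro: linear_const_times)

lemma ext_form_add: "ext_form a \<Longrightarrow> ext_form b \<Longrightarrow> ext_form (\<lambda>vs. a vs + b vs)"
  unfolding ext_form_def by (auto intro: linear_compose_add)

lemma ext_form_zero: "ext_form (\<lambda>vs. 0)"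
  by (auto simp: ext_form_def intro: linear_zero)

lemma ext_form_restrict_degree: "ext_form a \<Longrightarrow> ext_form (\<lambda>vs. if length vs = n then a vs else 0)"
  unfolding ext_form_def by (auto intro: linear_zero)

lemma ext_form_grade_sign: "ext_form a \<Longrightarrow> ext_form (grade_sign a)"
  unfolding ext_form_def grade_sign_def by (auto intro: linear_const_times)

lemma ext_form_unit_form: "ext_form unit_form"
  by (auto simp: ext_form_def unit_form_def intro: linear_zero)

lemma contract_add: "ext_form a \<Longrightarrow> contract (v + w) a = (\<lambda>vs. contract v a vs + contract w a vs)"
  and contract_scaleR: "ext_form a \<Longrightarrow> contract (r *\<^sub>R v) a = (\<lambda>vs. of_real r * contract v a vs)"
proof -
  assume a: "ext_form a"
  have lin: "linear (\<lambda>v. a (v # vs))" for vs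
  proof -
    have "\<forall>i<length (v # vs). linear (\<lambda>u. a ((v # vs)[i := u]))"
      using a unfolding ext_form_def by blast
    from this[rule_format, of 0] show ?thesis by simp
  qed
  show "contract (v + w) a = (\<lambda>vs. contract v a vs + contract w a vs)"
    "contract (r *\<^sub>R v) a = (\<lambda>vs. of_real r * contract v a vs)"
    by (simp_all add: fun_eq_iff contract_def linear_add[OF lin] linear_scale[OF lin] scaleR_conv_of_real)
qed

text \<open>Linearity in every argument is immediate from the recursion, but repeated vectors need not stand
  in front. Two equal leading vectors give zero by applying the recursion twice, so by polarisation the
  first two arguments may be exchanged; this moves a repetition into the tail, where the induction on the
  number of arguments applies.\<close>

lemma ext_form_wedge:
  assumes "ext_form a" "ext_form b"
  shows "ext_form (a \<and>\<^sub>w b)"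
proof -
  have "(\<forall>i<length vs. linear (\<lambda>v. (a \<and>\<^sub>w b) (vs[i := v]))) \<and> (\<not> distinct vs \<longrightarrow> (a \<and>\<^sub>w b) vs = 0)"
    if "length vs = n" "ext_form a" "ext_form b" for n vs and a b :: "'a form"
    using that
  proof (induction n arbitrary: a b vs)
    case 0
    then show ?case by simp
  next
    case (Suc n)
    obtain u us where vs: "vs = u # us" and us: "length us = n"
      using Suc.prems(1) by (cases vs) auto
    note a = \<open>ext_form a\<close> and b = \<open>ext_form b\<close>
    note IH1 = Suc.IH[OF _ ext_form_contract[OF a] b]
    note IH2 = Suc.IH[OF _ ext_form_grade_sign[OF a] ext_form_contract[OF b]]
    have head: "linear (\<lambda>v. (a \<and>\<^sub>w b) (v # ws))" for ws
      by (rule linearI)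
         (simp_all add: wedge_Cons contract_add[OF a] contract_add[OF b] contract_scaleR[OF a]
           contract_scaleR[OF b] wedge_add_left wedge_add_right wedge_scale_left wedge_scale_right
           scaleR_conv_of_real algebra_simps)
    have tail: "linear (\<lambda>v. (a \<and>\<^sub>w b) (w # ws[i := v]))" if "length ws = n" "i < n" for w ws i
      unfolding wedge_Cons using IH1[of ws w] IH2[of ws w] that by (intro linear_compose_add) auto
    have repeat: "(a \<and>\<^sub>w b) (v # v # ws) = 0" for v ws
    proof -
      have "contract v (contract v a) = (\<lambda>vs. 0)" "contract v (contract v b) = (\<lambda>vs. 0)"
        using a b by (auto simp: fun_eq_iff contract_def ext_form_def)
      then show ?thesis
        using wedge_scale_left[of "-1" "grade_sign (contract v a)" "contract v b"]
        by (simp add: wedge_Cons contract_grade_sign)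
    qed
    have swap: "(a \<and>\<^sub>w b) (v # w # ws) = - (a \<and>\<^sub>w b) (w # v # ws)" if "Suc (length ws) = n" for v w ws
    proof -
      have second: "linear (\<lambda>w. (a \<and>\<^sub>w b) (v # w # ws))" for v
        using tail[of "w # ws" 0 v] that by simp
      have "0 = (a \<and>\<^sub>w b) ((v + w) # (v + w) # ws)" by (rule repeat[symmetric])
      also have "\<dots> = (a \<and>\<^sub>w b) (v # (v + w) # ws) + (a \<and>\<^sub>w b) (w # (v + w) # ws)"
        by (rule linear_add[OF head])
      also have "\<dots> = (a \<and>\<^sub>w b) (v # w # ws) + (a \<and>\<^sub>w b) (w # v # ws)"
        by (simp add: linear_add[OF second] repeat)
      finally show ?thesis by (intro eq_neg_iff_add_eq_0[THEN iffD2]) simp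
    qed
    have "linear (\<lambda>v. (a \<and>\<^sub>w b) (vs[i := v]))" if "i < length vs" for i
      using head[of us] tail[of us _ u] that us by (cases i) (auto simp: vs)
    moreover have "(a \<and>\<^sub>w b) vs = 0" if "\<not> distinct vs"
    proof (cases "distinct us")
      case False
      then show ?thesis using IH1[of us u] IH2[of us u] us by (simp add: vs wedge_Cons)
    next
      case True
      with that have "u \<in> set us" by (simp add: vs)
      then obtain w ws where ws: "us = w # ws" by (cases us) auto
      show ?thesis
      proof (cases "u = w")
        case True
        then show ?thesis by (simp add: vs ws repeat)
      next
        case False
        then have "\<not> distinct (u # ws)" using \<open>u \<in> set us\<close> by (simp add: ws)
        then have "(a \<and>\<^sub>w b) (w # u # ws) = 0"
          using IH1[of "u # ws" w] IH2[of "u # ws" w] us by (simp add: ws wedge_Cons)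
        then show ?thesis using swap[of ws u w] us by (simp add: vs ws)
      qed
    qed
    ultimately show ?case by blast
  qed
  then show ?thesis using assms by (auto simp: ext_form_def)
qed

lemma integral_class_wedge:
  assumes "integral_class \<Lambda> a" "integral_class \<Lambda> b"
  shows "integral_class \<Lambda> (a \<and>\<^sub>w b)"
proof -
  have "(a \<and>\<^sub>w b) vs \<in> \<int>" if "set vs \<subseteq> \<Lambda>" for vs
  proof -
    have "a (nths vs S) \<in> \<int>" "b (nths vs S) \<in> \<int>" for S
      using assms that set_nths_subset[of vs S] unfolding integral_class_def by blast+
    then show ?thesis by (simp add: wedge_def Ints_sum Ints_mult Ints_power)
  qed
  then show ?thesis using assms by (simp add: integral_class_def ext_form_wedge)
qed

text \<open>When \<open>K\<close> is the kernel of a linear map, this says that a multilinear form factors through the map.\<close>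

definition annihilated_by :: "'v set \<Rightarrow> 'v form \<Rightarrow> bool" where
  "annihilated_by K a \<longleftrightarrow> (\<forall>vs. set vs \<inter> K \<noteq> {} \<longrightarrow> a vs = 0)"

lemma annihilated_by_wedge:
  assumes "annihilated_by K a" "annihilated_by K b"
  shows "annihilated_by K (a \<and>\<^sub>w b)"
  unfolding annihilated_by_def
proof (intro allI impI)
  fix vs assume "set vs \<inter> K \<noteq> {}"
  then obtain i where i: "i < length vs" "vs ! i \<in> K"
    by (metis disjoint_iff in_set_conv_nth)
  have "a (nths vs S) * b (nths vs (- S)) = 0" for S
  proof (cases "i \<in> S")
    case True
    then have "vs ! i \<in> set (nths vs S)" using i by (auto simp: set_nths)
    then show ?thesis using i assms by (auto simp: annihilated_by_def)
  next
    case False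
    then have "vs ! i \<in> set (nths vs (- S))" using i by (auto simp: set_nths)
    then show ?thesis using i assms by (auto simp: annihilated_by_def)
  qed
  then show "(a \<and>\<^sub>w b) vs = 0" unfolding wedge_def mult.assoc by (simp only: mult_zero_right sum.neutral_const)
qed

text \<open>More than \<open>DIM('w)\<close> vectors have linearly dependent images under \<open>g\<close>, so a nontrivial linear
  combination \<open>w\<close> of them lies in the kernel. Substituting \<open>w\<close> for one of the vectors gives zero, and by
  alternation it also gives a nonzero multiple of the original value.\<close>

lemma alternating_form_vanishes:
  fixes g :: "'v::real_vector \<Rightarrow> 'w::euclidean_space"
  assumes a: "ext_form a" and g: "linear g" and ann: "annihilated_by {v. g v = 0} a"
    and len: "length vs > DIM('w)"
  shows "a vs = 0"
proof (cases "distinct vs")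
  case False
  then show ?thesis using a by (simp add: ext_form_def)
next
  case True
  let ?S = "set vs"
  obtain u v0 where v0: "v0 \<in> ?S" "u v0 \<noteq> 0" and dep: "(\<Sum>v\<in>?S. u v *\<^sub>R g v) = 0"
  proof (cases "inj_on g ?S")
    case True
    then have "card (g ` ?S) > DIM('w)"
      using len \<open>distinct vs\<close> by (simp add: card_image distinct_card)
    then have "dependent (g ` ?S)" by (intro dependent_biggerset) auto
    then obtain u v where "v \<in> ?S" "u (g v) \<noteq> 0" "(\<Sum>w\<in>g ` ?S. u w *\<^sub>R w) = 0"
      by (auto simp: dependent_finite)
    with True show thesis
      by (intro that[of v "u \<circ> g"]) (auto simp: sum.reindex)
  next
    case False
    then obtain v w where vw: "v \<in> ?S" "w \<in> ?S" "v \<noteq> w" "g v = g w" by (auto simp: inj_on_def)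
    define u where "u x = (if x = v then 1 else if x = w then - 1 else 0 :: real)" for x
    have "(\<Sum>x\<in>?S. u x *\<^sub>R g x) = (\<Sum>x\<in>{v, w}. u x *\<^sub>R g x)"
      using vw by (intro sum.mono_neutral_right) (auto simp: u_def)
    also have "\<dots> = 0" using vw by (simp add: u_def)
    finally show thesis using vw by (intro that[of v u]) (auto simp: u_def)
  qed
  define w where "w = (\<Sum>v\<in>?S. u v *\<^sub>R v)"
  have "g w = 0" using dep by (simp add: w_def linear_sum[OF g] linear_scale[OF g])
  obtain i where i: "i < length vs" "vs ! i = v0" using v0 by (auto simp: in_set_conv_nth)
  have lin: "linear (\<lambda>v. a (vs[i := v]))" using a i by (simp add: ext_form_def)
  have other: "a (vs[i := v]) = 0" if "v \<in> ?S - {v0}" for v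
  proof -
    from that obtain j where j: "j < length vs" "vs ! j = v" "j \<noteq> i"
      using i by (auto simp: in_set_conv_nth)
    then have "vs[i := v] ! i = vs[i := v] ! j" using i by simp
    then have "\<not> distinct (vs[i := v])"
      using i j by (metis length_list_update nth_eq_iff_index_eq)
    then show ?thesis using a by (simp add: ext_form_def)
  qed
  have "0 = a (vs[i := w])"
    using ann \<open>g w = 0\<close> set_update_memI[OF i(1), of w] by (auto simp: annihilated_by_def)
  also have "\<dots> = (\<Sum>v\<in>?S. u v *\<^sub>R a (vs[i := v]))"
    by (simp add: w_def linear_sum[OF lin] linear_scale[OF lin])
  also have "\<dots> = u v0 *\<^sub>R a (vs[i := v0])"
    using v0 other by (subst sum.remove[of _ v0]) auto
  also have "vs[i := v0] = vs" using i by auto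
  finally show ?thesis using v0 by simp
qed

text \<open>With the identity as \<open>g\<close> in the preceding lemma this gives the vanishing of alternating forms of
  degree above the dimension.\<close>

lemma ext_form_annihilated_by_zero:
  fixes a :: "'v::real_vector form"
  shows "ext_form a \<Longrightarrow> annihilated_by {0} a"
  unfolding annihilated_by_def
proof (intro allI impI)
  fix vs :: "'v list" assume a: "ext_form a" and "set vs \<inter> {0} \<noteq> {}"
  then obtain i where i: "i < length vs" "vs ! i = 0" by (auto simp: in_set_conv_nth)
  then have "linear (\<lambda>v. a (vs[i := v]))" using a by (simp add: ext_form_def)
  from linear_0[OF this] show "a vs = 0" using i by (metis list_update_id)
qed

primrec wedge_power :: "'v form \<Rightarrow> nat \<Rightarrow> 'v form" where
  "wedge_power a 0 = unit_form"
| "wedge_power a (Suc k) = a \<and>\<^sub>w wedge_power a k"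

lemma wedge_power_scale: "wedge_power (\<lambda>vs. c * a vs) k = (\<lambda>vs. c ^ k * wedge_power a k vs)"
  by (induction k) (simp_all add: wedge_scale_left wedge_scale_right mult_ac)

lemma homogeneous_wedge_power: "homogeneous m a \<Longrightarrow> homogeneous (m * k) (wedge_power a k)"
proof (induction k)
  case (Suc k)
  then show ?case using homogeneous_wedge[of m a "m * k"] by simp
qed (simp add: homogeneous_def unit_form_def)

lemma ext_form_wedge_power: "ext_form a \<Longrightarrow> ext_form (wedge_power a k)"
  by (induction k) (simp_all add: ext_form_unit_form ext_form_wedge)

lemma integral_class_wedge_power: "integral_class \<Lambda> a \<Longrightarrow> integral_class \<Lambda> (wedge_power a k)"
proof (induction k)
  case 0
  show ?case by (simp add: integral_class_def ext_form_unit_form) (simp add: unit_form_def)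
qed (simp add: integral_class_wedge)

lemma annihilated_by_wedge_power: "annihilated_by K a \<Longrightarrow> annihilated_by K (wedge_power a k)"
proof (induction k)
  case 0
  show ?case by (auto simp: annihilated_by_def unit_form_def)
qed (simp add: annihilated_by_wedge)

section \<open>Smooth functions on open sets\<close>

text \<open>Transition functions are arbitrary outside the overlap of their charts, so their derivatives can
  only be compared through equalities on an open set.\<close>

lemma frechet_derivative_cong_open:
  assumes "open S" "x \<in> S" "\<And>y. y \<in> S \<Longrightarrow> f y = g y"
  shows "frechet_derivative f (at x) = frechet_derivative g (at x)"
proof -
  have "(f has_derivative f') (at x) \<longleftrightarrow> (g has_derivative f') (at x)" for f'
    using assms by (metis has_derivative_transform_within_open)
  then show ?thesis by (simp add: frechet_derivative_def)
qed

lemma frechet_derivative_add: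
  assumes "f differentiable (at x)" "g differentiable (at x)"
  shows "frechet_derivative (\<lambda>y. f y + g y) (at x) v = frechet_derivative f (at x) v + frechet_derivative g (at x) v"
  using frechet_derivative_at[OF has_derivative_add[OF assms[unfolded frechet_derivative_works]]]
  by (simp add: fun_eq_iff)

lemma frechet_derivative_times_const:
  fixes f :: "'v::real_normed_vector \<Rightarrow> complex"
  assumes "f differentiable (at x)"
  shows "frechet_derivative (\<lambda>y. k * f y) (at x) v = k * frechet_derivative f (at x) v"
  using frechet_derivative_at[OF has_derivative_mult_right[OF assms[unfolded frechet_derivative_works], of k]]
  by (simp add: fun_eq_iff)

lemma smooth_on_differentiable: "smooth_on f S \<Longrightarrow> x \<in> S \<Longrightarrow> f differentiable (at x)"
  unfolding smooth_on_def by (metis C_times_differentiable_on.simps(2))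

lemma C_times_differentiable_on_cong:
  assumes "open S" "\<And>y. y \<in> S \<Longrightarrow> f y = g y" "C_times_differentiable_on n f S"
  shows "C_times_differentiable_on n g S"
  using assms(2,3)
proof (induction n arbitrary: f g)
  case 0
  then show ?case by (simp cong: continuous_on_cong)
next
  case (Suc n)
  have "g differentiable (at x)" if "x \<in> S" for x
    using Suc.prems that assms(1) unfolding differentiable_def C_times_differentiable_on.simps
    by (metis has_derivative_transform_within_open)
  moreover have "C_times_differentiable_on n (\<lambda>x. frechet_derivative g (at x) v) S" for v
  proof (rule Suc.IH)
    show "frechet_derivative f (at x) v = frechet_derivative g (at x) v" if "x \<in> S" for x
      using frechet_derivative_cong_open[OF assms(1) that Suc.prems(1)] by simp
    show "C_times_differentiable_on n (\<lambda>x. frechet_derivative f (at x) v) S"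
      using Suc.prems(2) by simp
  qed
  ultimately show ?case by simp
qed

lemma smooth_on_cong:
  "open S \<Longrightarrow> (\<And>y. y \<in> S \<Longrightarrow> f y = g y) \<Longrightarrow> smooth_on f S \<Longrightarrow> smooth_on g S"
  using C_times_differentiable_on_cong[of S f g] unfolding smooth_on_def by blast

lemma smooth_on_const: "smooth_on (\<lambda>x. k) S"
proof -
  have "C_times_differentiable_on n (\<lambda>x::'a. k) S" for n k
    by (induction n arbitrary: k) simp_all
  then show ?thesis by (simp add: smooth_on_def)
qed

lemma smooth_on_add:
  assumes "open S" "smooth_on f S" "smooth_on g S"
  shows "smooth_on (\<lambda>x. f x + g x) S"
proof -
  have "C_times_differentiable_on n (\<lambda>x. f x + g x) S"
    if "C_times_differentiable_on n f S" "C_times_differentiable_on n g S" for n f g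
    using that
  proof (induction n arbitrary: f g)
    case (Suc n)
    then have *: "C_times_differentiable_on n
        (\<lambda>x. frechet_derivative f (at x) v + frechet_derivative g (at x) v) S" for v
      by simp
    have "C_times_differentiable_on n (\<lambda>x. frechet_derivative (\<lambda>y. f y + g y) (at x) v) S" for v
      by (rule C_times_differentiable_on_cong[OF assms(1) _ *[of v]])
         (use Suc.prems in \<open>simp add: frechet_derivative_add\<close>)
    then show ?case using Suc.prems by simp
  qed (auto intro: continuous_intros)
  then show ?thesis using assms by (simp add: smooth_on_def)
qed

lemma smooth_on_times_const:
  assumes "open S" "smooth_on f S"
  shows "smooth_on (\<lambda>x. k * f x) S"
proof -
  have "C_times_differentiable_on n (\<lambda>x. k * f x) S" if "C_times_differentiable_on n f S" for n f
    using that
  proof (induction n arbitrary: f)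
    case (Suc n)
    then have *: "C_times_differentiable_on n (\<lambda>x. k * frechet_derivative f (at x) v) S" for v
      by simp
    have "C_times_differentiable_on n (\<lambda>x. frechet_derivative (\<lambda>y. k * f y) (at x) v) S" for v
      by (rule C_times_differentiable_on_cong[OF assms(1) _ *[of v]])
         (use Suc.prems in \<open>simp add: frechet_derivative_times_const\<close>)
    then show ?case using Suc.prems by (simp add: differentiable_mult)
  qed (auto intro: continuous_intros)
  then show ?thesis using assms by (simp add: smooth_on_def)
qed

lemma smooth_on_subset: 
  assumes "smooth_on f S" "T \<subseteq> S"
  shows "smooth_on f T"
proof -
  have "C_times_differentiable_on n f T" if "C_times_differentiable_on n f S" for n f
    using that
  proof (induction n arbitrary: f)
    case 0
    then show ?case using assms(2) continuous_on_subset by auto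
  qed (use assms(2) in auto)
  then show ?thesis using assms(1) by (simp add: smooth_on_def)
qed

lemma torus_open_Int: "torus_open \<Lambda> U \<Longrightarrow> torus_open \<Lambda> W \<Longrightarrow> torus_open \<Lambda> (U \<inter> W)"
  unfolding torus_open_def by auto

lemma torus_smooth_subset: "torus_smooth \<Lambda> U f \<Longrightarrow> W \<subseteq> U \<Longrightarrow> torus_smooth \<Lambda> W f"
  unfolding torus_smooth_def by (auto intro: smooth_on_subset)

lemma torus_smooth_const: "torus_smooth \<Lambda> U (\<lambda>x. k)"
  by (simp add: torus_smooth_def smooth_on_const)

lemma torus_smooth_cong:
  assumes "torus_open \<Lambda> U" "\<And>y. y \<in> U \<Longrightarrow> f y = g y" "torus_smooth \<Lambda> U f"
  shows "torus_smooth \<Lambda> U g"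
  using assms smooth_on_cong[of U f g] unfolding torus_smooth_def torus_open_def by metis

lemma torus_diff_form_subset:
  "torus_diff_form \<Lambda> U w \<Longrightarrow> W \<subseteq> U \<Longrightarrow> torus_diff_form \<Lambda> W w"
  unfolding torus_diff_form_def by (auto intro: torus_smooth_subset)

lemma torus_diff_form_zero: "torus_diff_form \<Lambda> U (\<lambda>x vs. 0)"
  by (simp add: torus_diff_form_def torus_smooth_const ext_form_zero)

lemma torus_diff_form_add:
  "open U \<Longrightarrow> torus_diff_form \<Lambda> U w \<Longrightarrow> torus_diff_form \<Lambda> U w' \<Longrightarrow>
    torus_diff_form \<Lambda> U (\<lambda>x vs. w x vs + w' x vs)"
  by (simp add: torus_diff_form_def torus_smooth_def ext_form_add smooth_on_add)

lemma torus_diff_form_scale: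
  "open U \<Longrightarrow> torus_diff_form \<Lambda> U w \<Longrightarrow> torus_diff_form \<Lambda> U (\<lambda>x vs. k * w x vs)"
  by (simp add: torus_diff_form_def torus_smooth_def ext_form_scale smooth_on_times_const)

lemma torus_diff_form_restrict_degree:
  "torus_diff_form \<Lambda> U w \<Longrightarrow> torus_diff_form \<Lambda> U (\<lambda>x vs. if length vs = n then w x vs else 0)"
  unfolding torus_diff_form_def
proof (intro conjI ballI allI)
  fix vs
  assume "(\<forall>x\<in>U. ext_form (w x)) \<and> (\<forall>vs. torus_smooth \<Lambda> U (\<lambda>x. w x vs))"
  then show "torus_smooth \<Lambda> U (\<lambda>x. if length vs = n then w x vs else 0)"
    by (cases "length vs = n") (simp_all add: torus_smooth_const)
qed (simp add: ext_form_restrict_degree)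

section \<open>Direct sums and duals of bundles\<close>

lemma vector_bundleD:
  assumes "vector_bundle \<Lambda> E"
  shows chart_mem: "p \<in> chart E p"
    and chart_open: "torus_open \<Lambda> (chart E p)"
    and transition_carrier: "x \<in> chart E p \<Longrightarrow> x \<in> chart E q \<Longrightarrow>
      transition E p q x \<in> carrier_mat (vb_rank E) (vb_rank E)"
    and transition_smooth: "i < vb_rank E \<Longrightarrow> j < vb_rank E \<Longrightarrow>
      torus_smooth \<Lambda> (chart E p \<inter> chart E q) (\<lambda>x. transition E p q x $$ (i, j))"
    and transition_refl: "x \<in> chart E p \<Longrightarrow> transition E p p x = 1\<^sub>m (vb_rank E)"
    and transition_cocycle: "x \<in> chart E p \<Longrightarrow> x \<in> chart E q \<Longrightarrow> x \<in> chart E s \<Longrightarrow>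
      transition E p q x * transition E q s x = transition E p s x"
  using assms unfolding vector_bundle_def by blast+

lemma vector_bundle_dual_bundle:
  assumes E: "vector_bundle \<Lambda> E"
  shows "vector_bundle \<Lambda> (dual_bundle E)"
proof -
  have smooth: "torus_smooth \<Lambda> (chart E p \<inter> chart E q) (\<lambda>x. (transition E q p x)\<^sup>T $$ (i, j))"
    if ij: "i < vb_rank E" "j < vb_rank E" for p q i j
  proof (rule torus_smooth_cong)
    show "torus_open \<Lambda> (chart E p \<inter> chart E q)"
      by (intro torus_open_Int chart_open[OF E])
    show "torus_smooth \<Lambda> (chart E p \<inter> chart E q) (\<lambda>x. transition E q p x $$ (j, i))"
      using transition_smooth[OF E ij(2,1), of q p] by (simp add: Int_commute)
    show "transition E q p x $$ (j, i) = (transition E q p x)\<^sup>T $$ (i, j)"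
      if "x \<in> chart E p \<inter> chart E q" for x
      using transition_carrier[OF E, of x q p] that ij by auto
  qed
  have cocycle: "(transition E q p x)\<^sup>T * (transition E s q x)\<^sup>T = (transition E s p x)\<^sup>T"
    if x: "x \<in> chart E p" "x \<in> chart E q" "x \<in> chart E s" for p q s x
  proof -
    have "(transition E q p x)\<^sup>T * (transition E s q x)\<^sup>T = (transition E s q x * transition E q p x)\<^sup>T"
      using transition_carrier[OF E, of x q p] transition_carrier[OF E, of x s q] x
      by (subst transpose_mult) auto
    then show ?thesis using transition_cocycle[OF E, of x s q p] x by simp
  qed
  show ?thesis
    unfolding vector_bundle_def dual_bundle_def
    using chart_mem[OF E] chart_open[OF E] transition_carrier[OF E] smooth cocycle
      transition_refl[OF E] by simp
qed

lemma direct_sum_entry: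
  assumes "vector_bundle \<Lambda> E" "vector_bundle \<Lambda> F"
    and "x \<in> chart (direct_sum E F) p \<inter> chart (direct_sum E F) q"
    and "a < vb_rank E + vb_rank F" "b < vb_rank E + vb_rank F"
  shows "transition (direct_sum E F) p q x $$ (a, b) =
    (if a < vb_rank E then if b < vb_rank E then transition E p q x $$ (a, b) else 0
     else if b < vb_rank E then 0 else transition F p q x $$ (a - vb_rank E, b - vb_rank E))"
proof -
  have "transition E p q x \<in> carrier_mat (vb_rank E) (vb_rank E)"
    "transition F p q x \<in> carrier_mat (vb_rank F) (vb_rank F)"
    using transition_carrier[OF assms(1)] transition_carrier[OF assms(2)] assms(3)
    by (auto simp: direct_sum_def)
  then show ?thesis using assms(4,5) by (auto simp: direct_sum_def)
qed

lemma vector_bundle_direct_sum: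
  assumes E: "vector_bundle \<Lambda> E" and F: "vector_bundle \<Lambda> F"
  shows "vector_bundle \<Lambda> (direct_sum E F)"
proof -
  let ?D = "direct_sum E F" and ?r = "vb_rank E" and ?s = "vb_rank F"
  have open_D: "torus_open \<Lambda> (chart ?D p)" for p
    using chart_open[OF E] chart_open[OF F] by (simp add: direct_sum_def torus_open_Int)
  have carE: "transition E p q x \<in> carrier_mat ?r ?r" and carF: "transition F p q x \<in> carrier_mat ?s ?s"
    if "x \<in> chart ?D p \<inter> chart ?D q" for p q x
    using transition_carrier[OF E] transition_carrier[OF F] that by (auto simp: direct_sum_def)
  have smooth: "torus_smooth \<Lambda> (chart ?D p \<inter> chart ?D q) (\<lambda>x. transition ?D p q x $$ (i, j))"
    if ij: "i < ?r + ?s" "j < ?r + ?s" for p q i j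
  proof (rule torus_smooth_cong)
    let ?g = "\<lambda>x. if i < ?r then if j < ?r then transition E p q x $$ (i, j) else 0
      else if j < ?r then 0 else transition F p q x $$ (i - ?r, j - ?r)"
    show "torus_open \<Lambda> (chart ?D p \<inter> chart ?D q)" by (intro torus_open_Int open_D)
    show "?g x = transition ?D p q x $$ (i, j)" if "x \<in> chart ?D p \<inter> chart ?D q" for x
      using direct_sum_entry[OF E F that ij] by simp
    have "torus_smooth \<Lambda> (chart E p \<inter> chart E q) (\<lambda>x. transition E p q x $$ (i, j))"
      if "i < ?r" "j < ?r" using transition_smooth[OF E that] .
    moreover have "torus_smooth \<Lambda> (chart F p \<inter> chart F q) (\<lambda>x. transition F p q x $$ (i - ?r, j - ?r))"
      if "\<not> i < ?r" "\<not> j < ?r" using that ij by (intro transition_smooth[OF F]) auto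
    ultimately show "torus_smooth \<Lambda> (chart ?D p \<inter> chart ?D q) ?g"
      by (cases "i < ?r"; cases "j < ?r")
         (auto simp: direct_sum_def torus_smooth_const elim!: torus_smooth_subset)
  qed
  have cocycle: "transition ?D p q x * transition ?D q s x = transition ?D p s x"
    if x: "x \<in> chart ?D p" "x \<in> chart ?D q" "x \<in> chart ?D s" for p q s x
  proof -
    have "transition ?D p q x * transition ?D q s x =
      four_block_mat (transition E p q x * transition E q s x) (0\<^sub>m ?r ?s) (0\<^sub>m ?s ?r)
        (transition F p q x * transition F q s x)"
      unfolding direct_sum_def using carE[of x p q] carF[of x p q] carE[of x q s] carF[of x q s] x
      by (simp add: mult_four_block_mat[of _ ?r ?r _ ?s _ ?s _ _ ?r _ ?s])
    also have "\<dots> = transition ?D p s x"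
      using transition_cocycle[OF E] transition_cocycle[OF F] x by (simp add: direct_sum_def)
    finally show ?thesis .
  qed
  have one: "transition ?D p p x = 1\<^sub>m (?r + ?s)" if "x \<in> chart ?D p" for p x
    using transition_refl[OF E] transition_refl[OF F] that by (simp add: direct_sum_def)
  have rank: "vb_rank ?D = ?r + ?s" by (simp add: direct_sum_def)
  have mem: "p \<in> chart ?D p" for p
    using chart_mem[OF E] chart_mem[OF F] by (simp add: direct_sum_def)
  have car: "transition ?D p q x \<in> carrier_mat (?r + ?s) (?r + ?s)"
    if "x \<in> chart ?D p \<inter> chart ?D q" for p q x
    using carE[OF that] carF[OF that] by (simp add: direct_sum_def)
  show ?thesis
    unfolding vector_bundle_def rank using mem open_D car smooth one cocycle by blast
qed

section \<open>Connections on direct sums\<close>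

definition block_forms :: "nat \<Rightarrow> 'v form_matrix \<Rightarrow> 'v form_matrix \<Rightarrow> 'v form_matrix" where
  "block_forms r A B a b =
    (if a < r then if b < r then A a b else (\<lambda>vs. 0)
     else if b < r then (\<lambda>vs. 0) else B (a - r) (b - r))"

lemma sum_lessThan_add: "(\<Sum>c<r + s. f c) = (\<Sum>c<r. f c) + (\<Sum>c<s. f (r + c))"
  for f :: "nat \<Rightarrow> 'a::comm_monoid_add"
  by (induction s) (simp_all add: add.assoc)

lemma fm_power_block_forms:
  "fm_power (r + s) (block_forms r A B) k = block_forms r (fm_power r A k) (fm_power s B k)"
proof (induction k)
  case 0
  show ?case by (auto simp: fun_eq_iff block_forms_def)
next
  case (Suc k)
  show ?case
    by (intro ext) (simp add: Suc sum_lessThan_add, simp add: block_forms_def)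
qed

lemma ext_deriv_zero [simp]: "ext_deriv (\<lambda>x vs. 0) x vs = 0"
  by (simp add: ext_deriv_def)

lemma curvature_block_forms:
  "curvature (r + s) (\<lambda>x. block_forms r (th x) (th' x)) x =
    block_forms r (curvature r th x) (curvature s th' x)"
  by (intro ext) (simp add: curvature_def sum_lessThan_add, simp add: block_forms_def curvature_def)

lemma chern_character_form_block_forms:
  "chern_character_form (r + s) (block_forms r A B) vs =
    chern_character_form r A vs + chern_character_form s B vs"
  by (simp add: chern_character_form_def fm_power_block_forms sum_lessThan_add,
      simp add: block_forms_def distrib_left sum.distrib add_divide_distrib)

lemma connectionD:
  assumes "connection \<Lambda> E \<theta>"
  shows connection_diff_form: "a < vb_rank E \<Longrightarrow> b < vb_rank E \<Longrightarrow>
      torus_diff_form \<Lambda> (chart E p) (\<lambda>x. \<theta> p x a b)"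
    and connection_homogeneous: "a < vb_rank E \<Longrightarrow> b < vb_rank E \<Longrightarrow> x \<in> chart E p \<Longrightarrow>
      homogeneous 1 (\<theta> p x a b)"
    and connection_gauge: "a < vb_rank E \<Longrightarrow> b < vb_rank E \<Longrightarrow> x \<in> chart E p \<Longrightarrow> x \<in> chart E q \<Longrightarrow>
      (\<Sum>c<vb_rank E. transition E p q x $$ (a, c) * \<theta> q x c b [v]) =
      (\<Sum>c<vb_rank E. \<theta> p x a c [v] * transition E p q x $$ (c, b)) +
      frechet_derivative (\<lambda>y. transition E p q y $$ (a, b)) (at x) v"
  using assms unfolding connection_def by blast+

text \<open>The gauge law splits into the laws of the two summands. In the off-diagonal blocks the transition
  functions vanish on the overlap of the charts, which is open, so their derivatives vanish there too.\<close>

lemma connection_direct_sum: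
  assumes E: "vector_bundle \<Lambda> E" and F: "vector_bundle \<Lambda> F"
    and e: "connection \<Lambda> E \<theta>" and f: "connection \<Lambda> F \<theta>'"
  shows "connection \<Lambda> (direct_sum E F) (\<lambda>p x. block_forms (vb_rank E) (\<theta> p x) (\<theta>' p x))"
proof -
  let ?D = "direct_sum E F" and ?r = "vb_rank E" and ?s = "vb_rank F"
  let ?\<theta> = "\<lambda>p x. block_forms ?r (\<theta> p x) (\<theta>' p x)"
  have rank: "vb_rank ?D = ?r + ?s" by (simp add: direct_sum_def)
  have chartD: "chart ?D p = chart E p \<inter> chart F p" for p by (simp add: direct_sum_def)
  have diff: "torus_diff_form \<Lambda> (chart ?D p) (\<lambda>x. ?\<theta> p x a b)"
    if "a < ?r + ?s" "b < ?r + ?s" for p a b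
  proof -
    have "torus_diff_form \<Lambda> (chart E p) (\<lambda>x. \<theta> p x a b)" if "a < ?r" "b < ?r"
      using connection_diff_form[OF e that] .
    moreover have "torus_diff_form \<Lambda> (chart F p) (\<lambda>x. \<theta>' p x (a - ?r) (b - ?r))"
      if "\<not> a < ?r" "\<not> b < ?r"
      using that \<open>a < ?r + ?s\<close> \<open>b < ?r + ?s\<close> by (intro connection_diff_form[OF f]) auto
    ultimately show ?thesis
      unfolding block_forms_def chartD
      by (cases "a < ?r"; cases "b < ?r") (auto simp: torus_diff_form_zero elim!: torus_diff_form_subset)
  qed
  have hom: "homogeneous 1 (?\<theta> p x a b)"
    if "x \<in> chart ?D p" "a < ?r + ?s" "b < ?r + ?s" for p x a b
  proof -
    have "homogeneous 1 (\<theta> p x a b)" if "a < ?r" "b < ?r"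
      using connection_homogeneous[OF e that] \<open>x \<in> chart ?D p\<close> by (simp add: chartD)
    moreover have "homogeneous 1 (\<theta>' p x (a - ?r) (b - ?r))" if "\<not> a < ?r" "\<not> b < ?r"
      using that \<open>x \<in> chart ?D p\<close> \<open>a < ?r + ?s\<close> \<open>b < ?r + ?s\<close>
      by (intro connection_homogeneous[OF f]) (auto simp: chartD)
    ultimately show ?thesis
      by (simp add: block_forms_def homogeneous_def)
  qed
  have gauge: "(\<Sum>c<?r + ?s. transition ?D p q x $$ (a, c) * ?\<theta> q x c b [v]) =
      (\<Sum>c<?r + ?s. ?\<theta> p x a c [v] * transition ?D p q x $$ (c, b)) +
      frechet_derivative (\<lambda>y. transition ?D p q y $$ (a, b)) (at x) v"
    if x: "x \<in> chart ?D p \<inter> chart ?D q" and a: "a < ?r + ?s" and b: "b < ?r + ?s" for p q x a b v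
  proof -
    note entry = direct_sum_entry[OF E F]
    have "open (chart ?D p \<inter> chart ?D q)"
      using chart_open[OF E] chart_open[OF F] unfolding chartD torus_open_def
      by (intro open_Int) blast+
    then have deriv: "frechet_derivative (\<lambda>y. transition ?D p q y $$ (a, b)) (at x) =
        frechet_derivative (\<lambda>y. if a < ?r then if b < ?r then transition E p q y $$ (a, b) else 0
          else if b < ?r then 0 else transition F p q y $$ (a - ?r, b - ?r)) (at x)"
      by (rule frechet_derivative_cong_open[OF _ x]) (rule entry[OF _ a b])
    have left: "(\<Sum>c<?r + ?s. transition ?D p q x $$ (a, c) * ?\<theta> q x c b [v]) =
        (if a < ?r then if b < ?r then \<Sum>c<?r. transition E p q x $$ (a, c) * \<theta> q x c b [v] else 0
         else if b < ?r then 0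
           else \<Sum>c<?s. transition F p q x $$ (a - ?r, c) * \<theta>' q x c (b - ?r) [v])"
      using a b by (simp add: sum_lessThan_add entry[OF x] block_forms_def)
    have right: "(\<Sum>c<?r + ?s. ?\<theta> p x a c [v] * transition ?D p q x $$ (c, b)) =
        (if a < ?r then if b < ?r then \<Sum>c<?r. \<theta> p x a c [v] * transition E p q x $$ (c, b) else 0
         else if b < ?r then 0
           else \<Sum>c<?s. \<theta>' p x (a - ?r) c [v] * transition F p q x $$ (c, b - ?r))"
      using a b by (simp add: sum_lessThan_add entry[OF x] block_forms_def)
    have xE: "x \<in> chart E p" "x \<in> chart E q" and xF: "x \<in> chart F p" "x \<in> chart F q"
      using x by (auto simp: chartD)
    show ?thesis
      unfolding left right deriv
      using connection_gauge[OF e _ _ xE, of a b v] connection_gauge[OF f _ _ xF, of "a - ?r" "b - ?r" v] a b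
      by (cases "a < ?r"; cases "b < ?r") auto
  qed
  show ?thesis
    unfolding connection_def rank using diff hom gauge by blast
qed

text \<open>The Chern character form of a suitable connection is invariant, not merely cohomologous to an
  invariant form. This makes additivity on direct sums a pointwise statement.\<close>

definition invariant_chern_character :: "'v::euclidean_space set \<Rightarrow> 'v vbundle \<Rightarrow> 'v form \<Rightarrow> bool" where
  "invariant_chern_character \<Lambda> E \<alpha> \<longleftrightarrow> vector_bundle \<Lambda> E \<and> (\<exists>\<theta>. connection \<Lambda> E \<theta> \<and>
     (\<forall>p. \<forall>x\<in>chart E p. chern_character_form (vb_rank E) (curvature (vb_rank E) (\<theta> p) x) = \<alpha>))"

lemma has_chern_character_invariant:
  assumes "invariant_chern_character \<Lambda> E \<alpha>" "ext_form \<alpha>"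
  shows "has_chern_character \<Lambda> E \<alpha>"
proof -
  have "torus_diff_form \<Lambda> UNIV (\<lambda>x vs. 0)" by (rule torus_diff_form_zero)
  moreover have "ext_deriv (\<lambda>x vs. 0) x vs = 0" for x :: 'a and vs by simp
  ultimately show ?thesis
    using assms unfolding invariant_chern_character_def has_chern_character_def represents_def
    by (metis add.right_neutral)
qed

lemma invariant_chern_character_direct_sum:
  assumes "invariant_chern_character \<Lambda> E \<alpha>" "invariant_chern_character \<Lambda> F \<beta>"
  shows "invariant_chern_character \<Lambda> (direct_sum E F) (\<lambda>vs. \<alpha> vs + \<beta> vs)"
proof -
  obtain \<theta> \<theta>' where *: "vector_bundle \<Lambda> E" "vector_bundle \<Lambda> F" "connection \<Lambda> E \<theta>" "connection \<Lambda> F \<theta>'"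
    and E: "\<And>p x. x \<in> chart E p \<Longrightarrow> chern_character_form (vb_rank E) (curvature (vb_rank E) (\<theta> p) x) = \<alpha>"
    and F: "\<And>p x. x \<in> chart F p \<Longrightarrow> chern_character_form (vb_rank F) (curvature (vb_rank F) (\<theta>' p) x) = \<beta>"
    using assms unfolding invariant_chern_character_def by blast
  show ?thesis
    unfolding invariant_chern_character_def
  proof (intro conjI exI ballI allI)
    show "vector_bundle \<Lambda> (direct_sum E F)" using * by (intro vector_bundle_direct_sum)
    show "connection \<Lambda> (direct_sum E F) (\<lambda>p x. block_forms (vb_rank E) (\<theta> p x) (\<theta>' p x))"
      using * by (intro connection_direct_sum)
    fix p x assume "x \<in> chart (direct_sum E F) p"
    then show "chern_character_form (vb_rank (direct_sum E F))
        (curvature (vb_rank (direct_sum E F)) (\<lambda>x. block_forms (vb_rank E) (\<theta> p x) (\<theta>' p x)) x) =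
        (\<lambda>vs. \<alpha> vs + \<beta> vs)"
      using E[of x p] F[of x p]
      by (simp add: direct_sum_def curvature_block_forms chern_character_form_block_forms fun_eq_iff)
  qed
qed

lemma invariant_chern_character_sum_power:
  assumes "invariant_chern_character \<Lambda> E \<alpha>"
  shows "invariant_chern_character \<Lambda> (sum_power n E) (\<lambda>vs. of_nat n * \<alpha> vs)"
proof (induction n)
  case 0
  show ?case
    by (simp add: invariant_chern_character_def vector_bundle_def connection_def torus_open_def
      chern_character_form_def[abs_def])
next
  case (Suc n)
  show ?case
    using invariant_chern_character_direct_sum[OF assms Suc] by (simp add: distrib_right)
qed

section \<open>Line bundles\<close>

lemma ext_deriv_add_scale:
  assumes "\<And>ws. (\<lambda>y. a y ws) differentiable (at x)" "\<And>ws. (\<lambda>y. b y ws) differentiable (at x)"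
  shows "ext_deriv (\<lambda>y vs. a y vs + k * b y vs) x vs = ext_deriv a x vs + k * ext_deriv b x vs"
  using assms
  by (simp add: ext_deriv_def frechet_derivative_add frechet_derivative_times_const differentiable_mult
      algebra_simps sum.distrib sum_distrib_left)

lemma ext_deriv_restrict_degree:
  "ext_deriv (\<lambda>y vs. if length vs = n then a y vs else 0) x vs =
    (if length vs = Suc n then ext_deriv a x vs else 0)"
proof -
  have "length (take i vs @ drop (Suc i) vs) = n \<longleftrightarrow> length vs = Suc n" if "i < length vs" for i
    using that by auto
  then show ?thesis by (simp add: ext_deriv_def)
qed

text \<open>The curvature is taken in rank 1 because the notion is only used for line bundles.\<close>

definition invariant_first_chern_form :: "'v::euclidean_space set \<Rightarrow> 'v vbundle \<Rightarrow> 'v form \<Rightarrow> bool" where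
  "invariant_first_chern_form \<Lambda> L \<alpha> \<longleftrightarrow> (\<exists>\<theta>. connection \<Lambda> L \<theta> \<and>
     (\<forall>p. \<forall>x\<in>chart L p. first_chern_form 1 (curvature 1 (\<theta> p) x) = \<alpha>))"

text \<open>The quadratic term of the curvature is the square of a form of degree one.\<close>

lemma curvature_line:
  assumes "vb_rank L = 1" "connection \<Lambda> L \<theta>" "x \<in> chart L p"
  shows "curvature 1 (\<theta> p) x 0 0 = ext_deriv (\<lambda>y. \<theta> p y 0 0) x"
  using wedge_square_degree_one[OF connection_homogeneous[OF assms(2) _ _ assms(3), of 0 0]] assms(1)
  by (simp add: curvature_def fun_eq_iff)

lemma connection_differentiable:
  assumes "connection \<Lambda> L \<theta>" "x \<in> chart L p" "a < vb_rank L" "b < vb_rank L"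
  shows "(\<lambda>y. \<theta> p y a b ws) differentiable (at x)"
  using connection_diff_form[OF assms(1,3,4), of p] smooth_on_differentiable assms(2)
  unfolding torus_diff_form_def torus_smooth_def by blast

text \<open>Adding a global one-form \<open>k \<eta>\<^sub>1\<close> to a connection on a line bundle gives another connection and
  changes the first Chern form by \<open>\<i>/(2\<pi>) k d\<eta>\<^sub>1\<close>. With \<open>k = 2\<pi>\<i>\<close> the factor is -1, which cancels the exact
  term that separates the Chern form from \<open>\<alpha>\<close>.\<close>

lemma invariant_first_chern_form:
  assumes L: "line_bundle \<Lambda> L" and c1: "has_first_chern_class \<Lambda> L \<alpha>" and \<alpha>: "homogeneous 2 \<alpha>"
  shows "invariant_first_chern_form \<Lambda> L \<alpha>"
proof -
  have vb: "vector_bundle \<Lambda> L" and rank: "vb_rank L = 1" using L by (auto simp: line_bundle_def)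
  obtain \<theta> \<eta> where \<theta>: "connection \<Lambda> L \<theta>" and \<eta>: "torus_diff_form \<Lambda> UNIV \<eta>"
    and form: "\<And>p x vs. x \<in> chart L p \<Longrightarrow>
      first_chern_form 1 (curvature 1 (\<theta> p) x) vs = \<alpha> vs + ext_deriv \<eta> x vs"
    using c1 unfolding has_first_chern_class_def represents_def rank by blast
  \<comment> \<open>Only the part of degree one contributes to a two-form; the other parts would spoil homogeneity.\<close>
  define \<eta>1 where "\<eta>1 x vs = (if length vs = 1 then \<eta> x vs else 0)" for x vs
  define k where "k = 2 * of_real pi * \<i>"
  define \<theta>' where "\<theta>' p x a b = (\<lambda>vs. \<theta> p x a b vs + k * \<eta>1 x vs)" for p x and a b :: nat
  have \<eta>1: "torus_diff_form \<Lambda> UNIV \<eta>1"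
    unfolding \<eta>1_def by (rule torus_diff_form_restrict_degree[OF \<eta>])
  have diff_\<eta>1: "(\<lambda>y. \<eta>1 y ws) differentiable (at x)" for x ws
    using \<eta>1 smooth_on_differentiable unfolding torus_diff_form_def torus_smooth_def by blast
  have \<theta>': "connection \<Lambda> L \<theta>'"
    unfolding connection_def rank
  proof (intro conjI allI impI ballI)
    fix p a b assume ab: "a < (1::nat)" "b < (1::nat)"
    have "open (chart L p)" using chart_open[OF vb] by (simp add: torus_open_def)
    then show "torus_diff_form \<Lambda> (chart L p) (\<lambda>x. \<theta>' p x a b)"
      unfolding \<theta>'_def using connection_diff_form[OF \<theta>, of a b p] \<eta>1 ab rank
      by (intro torus_diff_form_add torus_diff_form_scale) (auto elim: torus_diff_form_subset)
    fix x assume "x \<in> chart L p"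
    then show "homogeneous 1 (\<theta>' p x a b)"
      using connection_homogeneous[OF \<theta>, of a b x p] ab rank
      by (simp add: \<theta>'_def \<eta>1_def homogeneous_def)
  next
    fix p q x a b v assume x: "x \<in> chart L p \<inter> chart L q" and ab: "a < (1::nat)" "b < (1::nat)"
    show "(\<Sum>c<1. transition L p q x $$ (a, c) * \<theta>' q x c b [v]) =
        (\<Sum>c<1. \<theta>' p x a c [v] * transition L p q x $$ (c, b)) +
        frechet_derivative (\<lambda>y. transition L p q y $$ (a, b)) (at x) v"
      using connection_gauge[OF \<theta>, of 0 0 x p q v] x ab
      by (simp add: rank \<theta>'_def algebra_simps)
  qed
  moreover have "first_chern_form 1 (curvature 1 (\<theta>' p) x) = \<alpha>" if x: "x \<in> chart L p" for p x
  proof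
    fix vs
    have k: "\<i> / (2 * of_real pi) * k = -1" by (simp add: k_def)
    have zero: "ext_deriv (\<lambda>y. \<theta> p y 0 0) x vs = 0" if "length vs \<noteq> 2"
    proof -
      have "frechet_derivative (\<lambda>y. \<theta> p y 0 0 ws) (at x) v = 0" if "length ws \<noteq> 1" for ws v
      proof -
        have "frechet_derivative (\<lambda>y. \<theta> p y 0 0 ws) (at x) = frechet_derivative (\<lambda>y. 0) (at x)"
          by (rule frechet_derivative_cong_open[OF _ x])
             (use chart_open[OF vb, of p] connection_homogeneous[OF \<theta>, of 0 0 _ p] that rank in
               \<open>auto simp: torus_open_def homogeneous_def\<close>)
        then show ?thesis by simp
      qed
      moreover have "length (take i vs @ drop (Suc i) vs) \<noteq> 1" if "i < length vs" for i
        using that \<open>length vs \<noteq> 2\<close> by auto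
      ultimately show ?thesis by (simp add: ext_deriv_def)
    qed
    have "first_chern_form 1 (curvature 1 (\<theta>' p) x) vs =
        \<i> / (2 * of_real pi) * ext_deriv (\<lambda>y. \<theta>' p y 0 0) x vs"
      using curvature_line[OF rank \<theta>' x] by (simp add: first_chern_form_def)
    also have "ext_deriv (\<lambda>y. \<theta>' p y 0 0) x vs =
        ext_deriv (\<lambda>y. \<theta> p y 0 0) x vs + k * ext_deriv \<eta>1 x vs"
      unfolding \<theta>'_def by (rule ext_deriv_add_scale[OF connection_differentiable[OF \<theta> x] diff_\<eta>1])
        (simp_all add: rank)
    also have "ext_deriv \<eta>1 x vs = (if length vs = 2 then ext_deriv \<eta> x vs else 0)"
      using ext_deriv_restrict_degree[of 1 \<eta> x vs] by (simp add: \<eta>1_def[abs_def] numeral_2_eq_2)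
    also have "\<i> / (2 * of_real pi) * (ext_deriv (\<lambda>y. \<theta> p y 0 0) x vs +
        k * (if length vs = 2 then ext_deriv \<eta> x vs else 0)) = \<alpha> vs"
    proof (cases "length vs = 2")
      case True
      have "\<i> / (2 * of_real pi) * ext_deriv (\<lambda>y. \<theta> p y 0 0) x vs = \<alpha> vs + ext_deriv \<eta> x vs"
        using form[OF x, of vs] curvature_line[OF rank \<theta> x] by (simp add: first_chern_form_def)
      then show ?thesis using True k by (simp only: distrib_left mult.assoc[symmetric]) simp
    next
      case False
      then show ?thesis using zero \<alpha> by (simp add: homogeneous_def)
    qed
    finally show "first_chern_form 1 (curvature 1 (\<theta>' p) x) vs = \<alpha> vs" .
  qed
  ultimately show ?thesis unfolding invariant_first_chern_form_def by blast
qed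

text \<open>The negative of the connection form satisfies the gauge law for the inverse transition functions:
  the law for \<open>L\<close> with the two charts exchanged, rearranged.\<close>

lemma invariant_first_chern_form_dual:
  assumes L: "line_bundle \<Lambda> L" and c1: "invariant_first_chern_form \<Lambda> L \<alpha>"
  shows "invariant_first_chern_form \<Lambda> (dual_bundle L) (\<lambda>vs. - \<alpha> vs)"
proof -
  have vb: "vector_bundle \<Lambda> L" and rank: "vb_rank L = 1" using L by (auto simp: line_bundle_def)
  obtain \<theta> where \<theta>: "connection \<Lambda> L \<theta>"
    and form: "\<And>p x. x \<in> chart L p \<Longrightarrow> first_chern_form 1 (curvature 1 (\<theta> p) x) = \<alpha>"
    using c1 unfolding invariant_first_chern_form_def by blast
  define \<theta>' where "\<theta>' p x a b = (\<lambda>vs. - 1 * \<theta> p x b a vs)" for p x and a b :: nat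
  have rank': "vb_rank (dual_bundle L) = 1" and chart': "chart (dual_bundle L) p = chart L p" for p
    by (simp_all add: dual_bundle_def rank)
  have \<theta>': "connection \<Lambda> (dual_bundle L) \<theta>'"
    unfolding connection_def rank' chart'
  proof (intro conjI allI impI ballI)
    fix p a b assume ab: "a < (1::nat)" "b < (1::nat)"
    have "open (chart L p)" using chart_open[OF vb] by (simp add: torus_open_def)
    then show "torus_diff_form \<Lambda> (chart L p) (\<lambda>x. \<theta>' p x a b)"
      unfolding \<theta>'_def using connection_diff_form[OF \<theta>, of b a p] ab rank
      by (intro torus_diff_form_scale) auto
    fix x assume "x \<in> chart L p"
    then show "homogeneous 1 (\<theta>' p x a b)"
      using connection_homogeneous[OF \<theta>, of b a x p] ab rank
      by (simp add: \<theta>'_def homogeneous_def)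
  next
    fix p q x a b v assume x: "x \<in> chart L p \<inter> chart L q" and ab: "a < (1::nat)" "b < (1::nat)"
    have entry: "(transition L q p y)\<^sup>T $$ (0, 0) = transition L q p y $$ (0, 0)"
      if "y \<in> chart L p \<inter> chart L q" for y
      using transition_carrier[OF vb, of y q p] that rank by auto
    have "frechet_derivative (\<lambda>y. (transition L q p y)\<^sup>T $$ (0, 0)) (at x) =
        frechet_derivative (\<lambda>y. transition L q p y $$ (0, 0)) (at x)"
      by (rule frechet_derivative_cong_open[OF _ x entry])
         (use chart_open[OF vb] in \<open>auto simp: torus_open_def\<close>)
    then show "(\<Sum>c<1. transition (dual_bundle L) p q x $$ (a, c) * \<theta>' q x c b [v]) =
        (\<Sum>c<1. \<theta>' p x a c [v] * transition (dual_bundle L) p q x $$ (c, b)) +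
        frechet_derivative (\<lambda>y. transition (dual_bundle L) p q y $$ (a, b)) (at x) v"
      using connection_gauge[OF \<theta>, of 0 0 x q p v] x ab entry[OF x]
      by (simp add: rank \<theta>'_def dual_bundle_def algebra_simps)
  qed
  moreover have "first_chern_form 1 (curvature 1 (\<theta>' p) x) = (\<lambda>vs. - \<alpha> vs)" if x: "x \<in> chart L p" for p x
  proof
    fix vs
    have x': "x \<in> chart (dual_bundle L) p" using x by (simp add: chart')
    have "ext_deriv (\<lambda>y. \<theta>' p y 0 0) x vs = - ext_deriv (\<lambda>y. \<theta> p y 0 0) x vs"
      using ext_deriv_add_scale[of "\<lambda>y vs. 0" x "\<lambda>y. \<theta> p y 0 0" "-1" vs]
        connection_differentiable[OF \<theta> x, of 0 0] rank by (simp add: \<theta>'_def)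
    then show "first_chern_form 1 (curvature 1 (\<theta>' p) x) vs = - \<alpha> vs"
      using curvature_line[OF rank' \<theta>' x'] curvature_line[OF rank \<theta> x] form[OF x]
      by (auto simp: first_chern_form_def fun_eq_iff)
  qed
  ultimately show ?thesis
    unfolding invariant_first_chern_form_def chart' by blast
qed

lemma fm_power_rank_one: "fm_power 1 W k 0 0 = wedge_power (W 0 0) k"
  by (induction k) simp_all

lemma invariant_chern_character_line:
  assumes L: "line_bundle \<Lambda> L" and c1: "invariant_first_chern_form \<Lambda> L \<alpha>"
  shows "invariant_chern_character \<Lambda> (L :: 'v::euclidean_space vbundle)
    (\<lambda>vs. \<Sum>k\<le>DIM('v). wedge_power \<alpha> k vs / fact k)"
proof -
  have vb: "vector_bundle \<Lambda> L" and rank: "vb_rank L = 1" using L by (auto simp: line_bundle_def)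
  obtain \<theta> where \<theta>: "connection \<Lambda> L \<theta>"
    and form: "\<And>p x. x \<in> chart L p \<Longrightarrow> first_chern_form 1 (curvature 1 (\<theta> p) x) = \<alpha>"
    using c1 unfolding invariant_first_chern_form_def by blast
  have "chern_character_form 1 (curvature 1 (\<theta> p) x) = (\<lambda>vs. \<Sum>k\<le>DIM('v). wedge_power \<alpha> k vs / fact k)"
    if "x \<in> chart L p" for p x
  proof -
    let ?W = "curvature 1 (\<theta> p) x"
    have "\<alpha> = (\<lambda>vs. \<i> / (2 * of_real pi) * ?W 0 0 vs)"
      using form[OF that] by (auto simp: first_chern_form_def fun_eq_iff)
    then have "wedge_power \<alpha> k = (\<lambda>vs. (\<i> / (2 * of_real pi)) ^ k * fm_power 1 ?W k 0 0 vs)" for k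
      by (simp only: fm_power_rank_one wedge_power_scale)
    then show ?thesis by (simp add: chern_character_form_def fun_eq_iff)
  qed
  then show ?thesis using vb \<theta> rank unfolding invariant_chern_character_def by auto
qed

text \<open>The series is cut off at \<open>k = DIM('v)\<close>, which may lie below 4 or far above it. Comparison with the
  three terms \<open>k = 0, 2, 4\<close> uses two vanishing arguments: a power beyond the cut-off has degree above
  \<open>DIM('v)\<close>, and a power with \<open>k > 4\<close> has degree above the dimension 8 of the space through which \<open>\<alpha>\<close> factors.\<close>

lemma invariant_chern_character_line_plus_dual:
  fixes L :: "'v::euclidean_space vbundle" and g :: "'v \<Rightarrow> 'w::euclidean_space"
  assumes L: "line_bundle \<Lambda> L" and c1: "has_first_chern_class \<Lambda> L \<alpha>"
    and \<alpha>: "ext_form \<alpha>" "homogeneous 2 \<alpha>" 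
    and g: "linear g" "DIM('w) = 8" and ann: "annihilated_by {v. g v = 0} \<alpha>"
  shows "invariant_chern_character \<Lambda> (direct_sum L (dual_bundle L))
    (\<lambda>vs. 2 * unit_form vs + (\<alpha> \<and>\<^sub>w \<alpha>) vs + wedge_power \<alpha> 4 vs / 12)"
proof -
  have dual: "line_bundle \<Lambda> (dual_bundle L)"
    using L by (auto simp: line_bundle_def vector_bundle_dual_bundle) (simp add: dual_bundle_def)
  note c1 = invariant_first_chern_form[OF L c1 \<alpha>(2)]
  have sum: "(\<Sum>k\<le>DIM('v). wedge_power \<alpha> k vs / fact k) +
      (\<Sum>k\<le>DIM('v). wedge_power (\<lambda>vs. - \<alpha> vs) k vs / fact k) =
      2 * unit_form vs + (\<alpha> \<and>\<^sub>w \<alpha>) vs + wedge_power \<alpha> 4 vs / 12" for vs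
  proof -
    define f where "f k = (wedge_power \<alpha> k vs + (- 1) ^ k * wedge_power \<alpha> k vs) / fact k" for k
    have "wedge_power (\<lambda>vs. - \<alpha> vs) k vs = (- 1) ^ k * wedge_power \<alpha> k vs" for k
      using wedge_power_scale[of "-1" \<alpha> k] by simp
    then have "(\<Sum>k\<le>DIM('v). wedge_power \<alpha> k vs / fact k) +
        (\<Sum>k\<le>DIM('v). wedge_power (\<lambda>vs. - \<alpha> vs) k vs / fact k) = (\<Sum>k\<le>DIM('v). f k)"
      by (simp add: f_def sum.distrib add_divide_distrib)
    also have "\<dots> = (\<Sum>k\<in>{..DIM('v)} \<union> {0, 2, 4}. f k)"
    proof (rule sum.mono_neutral_left)
      show "\<forall>k\<in>{..DIM('v)} \<union> {0, 2, 4} - {..DIM('v)}. f k = 0"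
      proof
        fix k assume "k \<in> {..DIM('v)} \<union> {0, 2, 4} - {..DIM('v)}"
        then have k: "2 * k > DIM('v)" by auto
        have "wedge_power \<alpha> k vs = 0"
        proof (cases "length vs = 2 * k")
          case True
          then show ?thesis
            using k alternating_form_vanishes[OF ext_form_wedge_power[OF \<alpha>(1)] linear_id, of k vs]
              ext_form_annihilated_by_zero[OF ext_form_wedge_power[OF \<alpha>(1)], of k] by simp
        next
          case False
          then show ?thesis using homogeneous_wedge_power[OF \<alpha>(2), of k] by (simp add: homogeneous_def)
        qed
        then show "f k = 0" by (simp add: f_def)
      qed
    qed auto
    also have "\<dots> = (\<Sum>k\<in>{0, 2, 4}. f k)"
    proof (rule sum.mono_neutral_right)
      show "\<forall>k\<in>{..DIM('v)} \<union> {0, 2, 4} - {0, 2, 4}. f k = 0"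
      proof
        fix k assume "k \<in> {..DIM('v)} \<union> {0, 2, 4} - {0, 2, 4}"
        then have "k \<noteq> 0" "k \<noteq> 2" "k \<noteq> 4" by auto
        then have k: "odd k \<or> 2 * k > 8" by presburger
        have "wedge_power \<alpha> k vs = 0" if "2 * k > 8"
        proof (cases "length vs = 2 * k")
          case True
          then show ?thesis
            using that g(2) alternating_form_vanishes[OF ext_form_wedge_power[OF \<alpha>(1)] g(1)
              annihilated_by_wedge_power[OF ann], of vs k] by simp
        next
          case False
          then show ?thesis using homogeneous_wedge_power[OF \<alpha>(2), of k] by (simp add: homogeneous_def)
        qed
        then show "f k = 0" using k by (auto simp: f_def)
      qed
    qed auto
    also have "\<dots> = 2 * unit_form vs + (\<alpha> \<and>\<^sub>w \<alpha>) vs + wedge_power \<alpha> 4 vs / 12"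
    proof -
      have "wedge_power \<alpha> 2 = \<alpha> \<and>\<^sub>w \<alpha>" by (simp add: numeral_2_eq_2)
      moreover have "fact 4 = (24 :: complex)" by (simp add: fact_numeral)
      ultimately show ?thesis by (simp add: f_def)
    qed
    finally show ?thesis .
  qed
  show ?thesis
    using invariant_chern_character_direct_sum[OF invariant_chern_character_line[OF L c1]
      invariant_chern_character_line[OF dual invariant_first_chern_form_dual[OF L c1]]]
    unfolding sum .
qed

section \<open>The classes attached to the roots\<close>

lemma sum_pairs: "(\<Sum>j=1..4. \<Sum>i=1..<j. f i j) = f 1 2 + f 1 3 + f 2 3 + f 1 4 + f 2 4 + f 3 4"
  for f :: "nat \<Rightarrow> nat \<Rightarrow> 'a::comm_monoid_add"
proof -
  have "{1..4} = {1, 2, 3, 4::nat}" "{1..<1} = ({} :: nat set)" "{1..<2} = {1::nat}"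
    "{1..<3} = {1, 2::nat}" "{1..<4} = {1, 2, 3::nat}"
    by auto
  then show ?thesis by (simp add: ac_simps)
qed

lemma root_disc_eq: "root_disc x = (x 1 - x 2) * (x 1 - x 3) * (x 2 - x 3) * (x 1 - x 4) * (x 2 - x 4) * (x 3 - x 4)"
proof -
  have "{1..4} = {1, 2, 3, 4::nat}" "{1..<1} = ({} :: nat set)" "{1..<2} = {1::nat}"
    "{1..<3} = {1, 2::nat}" "{1..<4} = {1, 2, 3::nat}"
    by auto
  then show ?thesis by (simp add: root_disc_def ac_simps)
qed

text \<open>Among the products of two basic two-forms only those with disjoint indices survive, each pair twice;
  up to this factor 2 the coefficient is the Pfaffian of the skew-symmetric matrix of the \<open>c i j\<close>.\<close>

lemma wedge_square_degree_two:
  fixes e :: "nat \<Rightarrow> 'v form" and c :: "nat \<Rightarrow> nat \<Rightarrow> complex"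
  assumes e: "\<And>i. homogeneous 1 (e i)"
  defines "P \<equiv> \<lambda>vs. \<Sum>j=1..4. \<Sum>i=1..<j. c i j * (e i \<and>\<^sub>w e j) vs"
  shows "P \<and>\<^sub>w P = (\<lambda>vs. 2 * (c 1 2 * c 3 4 - c 1 3 * c 2 4 + c 1 4 * c 2 3) *
    (e 1 \<and>\<^sub>w e 2 \<and>\<^sub>w e 3 \<and>\<^sub>w e 4) vs)"
proof -
  have P: "P = (\<lambda>vs. c 1 2 * (e 1 \<and>\<^sub>w e 2) vs + c 1 3 * (e 1 \<and>\<^sub>w e 3) vs + c 2 3 * (e 2 \<and>\<^sub>w e 3) vs
      + c 1 4 * (e 1 \<and>\<^sub>w e 4) vs + c 2 4 * (e 2 \<and>\<^sub>w e 4) vs + c 3 4 * (e 3 \<and>\<^sub>w e 4) vs)"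
    by (simp only: P_def sum_pairs)
  have minus: "a \<and>\<^sub>w (\<lambda>vs. - b vs) = (\<lambda>vs. - (a \<and>\<^sub>w b) vs)" "(\<lambda>vs. - a vs) \<and>\<^sub>w b = (\<lambda>vs. - (a \<and>\<^sub>w b) vs)"
    for a b :: "'v form"
    using wedge_scale_right[of a "- 1" b] wedge_scale_left[of "- 1" a b] by simp_all
  have swap: "e j \<and>\<^sub>w e i = (\<lambda>vs. - (e i \<and>\<^sub>w e j) vs)"
    "e j \<and>\<^sub>w e i \<and>\<^sub>w b = (\<lambda>vs. - (e i \<and>\<^sub>w e j \<and>\<^sub>w b) vs)" for i j b
    using wedge_degree_one_commute[OF e e, of j i] by (simp_all add: minus flip: wedge_assoc)
  have square: "e i \<and>\<^sub>w e i = (\<lambda>vs. 0)" "e i \<and>\<^sub>w e i \<and>\<^sub>w b = (\<lambda>vs. 0)" for i b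
    using wedge_square_degree_one[OF e, of i] by (simp_all flip: wedge_assoc)
  note swaps = swap[of 2 1] swap[of 3 1] swap[of 4 1] swap[of 3 2] swap[of 4 2] swap[of 4 3]
  show ?thesis
    unfolding P
    by (simp only: wedge_add_left wedge_add_right wedge_scale_left wedge_scale_right wedge_assoc
        swaps square minus wedge_zero_right) (simp add: algebra_simps)
qed

text \<open>With \<open>h\<^sub>2, h\<^sub>3, h\<^sub>4\<close> the resolvents of the four roots, the left-hand side is
  \<open>h\<^sub>2\<^sup>2 (h\<^sub>3 - h\<^sub>4) - h\<^sub>3\<^sup>2 (h\<^sub>2 - h\<^sub>4) + h\<^sub>4\<^sup>2 (h\<^sub>2 - h\<^sub>3) = (h\<^sub>2 - h\<^sub>3) (h\<^sub>2 - h\<^sub>4) (h\<^sub>3 - h\<^sub>4)\<close>, and each of the three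
  factors is a product of two complementary root differences.\<close>

lemma vandermonde_of_resolvents:
  fixes x :: "nat \<Rightarrow> real"
  defines "c \<equiv> \<lambda>i j. h_coeff x i j * (x i - x j)"
  shows "c 1 2 * c 3 4 - c 1 3 * c 2 4 + c 1 4 * c 2 3 = root_disc x"
proof -
  have "(a * b + c * d) * (a - b) * ((a * b + c * d) * (c - d)) -
      (a * c + b * d) * (a - c) * ((a * c + b * d) * (b - d)) +
      (a * d + b * c) * (a - d) * ((a * d + b * c) * (b - c)) =
      (a - b) * (a - c) * (b - c) * (a - d) * (b - d) * (c - d)" for a b c d :: real
    by (simp add: algebra_simps)
  from this[of "x 1" "x 2" "x 3" "x 4"] show ?thesis
    by (simp add: c_def root_disc_eq h_coeff_def)
qed

lemma homogeneous_e_form: "homogeneous 1 (e_form z j)"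
  by (auto simp: homogeneous_def e_form_def dz_def dzbar_def conj_form_def covector_def split: list.split)

lemma A_plus_square:
  "A_plus x z \<and>\<^sub>w A_plus x z =
    (\<lambda>vs. 2 * of_real (root_disc x) * (e_form z 1 \<and>\<^sub>w e_form z 2 \<and>\<^sub>w e_form z 3 \<and>\<^sub>w e_form z 4) vs)"
proof -
  have "complex_of_real (root_disc x) =
    of_real (h_coeff x 1 2 * (x 1 - x 2)) * of_real (h_coeff x 3 4 * (x 3 - x 4)) -
    of_real (h_coeff x 1 3 * (x 1 - x 3)) * of_real (h_coeff x 2 4 * (x 2 - x 4)) +
    of_real (h_coeff x 1 4 * (x 1 - x 4)) * of_real (h_coeff x 2 3 * (x 2 - x 3))"
    using vandermonde_of_resolvents[of x]
    by (simp only: of_real_mult[symmetric] of_real_diff[symmetric] of_real_add[symmetric])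
  then show ?thesis
    using wedge_square_degree_two[of "e_form z", OF homogeneous_e_form,
        where c = "\<lambda>i j. of_real (h_coeff x i j * (x i - x j))"]
    unfolding A_plus_def[symmetric, abs_def] by simp
qed

lemma conj_conj_form [simp]: "conj_form (conj_form a) = a"
  by (simp add: fun_eq_iff conj_form_def)

lemma M_form_eq:
  "M_form x z vs = of_real (root_disc x) *
    ((e_form z 1 \<and>\<^sub>w e_form z 2 \<and>\<^sub>w e_form z 3 \<and>\<^sub>w e_form z 4) vs +
     conj_form (e_form z 1 \<and>\<^sub>w e_form z 2 \<and>\<^sub>w e_form z 3 \<and>\<^sub>w e_form z 4) vs)"
  by (simp add: M_form_def conj_wedge e_form_def dzbar_def)

text \<open>With \<open>A\<^sub>2 = k (P - Q)\<close> and \<open>k\<^sup>2 = - c\<^sup>2 \<Delta>\<close>, subtracting \<open>A\<^sub>2\<^sup>2\<close> adds \<open>c\<^sup>2 \<Delta> (P - Q)\<^sup>2\<close> to \<open>c\<^sup>2 \<Delta> (P + Q)\<^sup>2\<close>: the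
  mixed terms cancel and the squares double.\<close>

lemma A_squares_difference:
  fixes x :: "nat \<Rightarrow> real"
  assumes "(root_disc x)\<^sup>2 = of_int \<Delta>"
  shows "of_int (c\<^sup>2 * \<Delta>) * (A_one x z \<and>\<^sub>w A_one x z) vs - (A_two x z c \<and>\<^sub>w A_two x z c) vs =
    4 * of_int (c\<^sup>2 * \<Delta>) * M_form x z vs"
proof -
  let ?P = "A_plus x z" and ?Q = "conj_form (A_plus x z)"
  let ?k = "\<i> * of_int c * of_real (root_disc x) :: complex"
  have "complex_of_real (root_disc x) ^ 2 = of_int \<Delta>"
    using arg_cong[OF assms, of complex_of_real] by simp
  then have k: "?k * ?k = - of_int (c\<^sup>2 * \<Delta>)"
    by (simp add: power2_eq_square algebra_simps)
  have one: "A_one x z = (\<lambda>vs. ?P vs + ?Q vs)"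
    by (simp add: fun_eq_iff A_one_def)
  have two: "A_two x z c = (\<lambda>vs. ?k * (?P vs + (- 1) * ?Q vs))"
    by (simp add: fun_eq_iff A_two_def)
  have QQ: "(?Q \<and>\<^sub>w ?Q) vs = cnj ((?P \<and>\<^sub>w ?P) vs)"
    by (simp add: conj_form_def flip: conj_wedge)
  have "(A_one x z \<and>\<^sub>w A_one x z) vs = (?P \<and>\<^sub>w ?P) vs + (?P \<and>\<^sub>w ?Q) vs + (?Q \<and>\<^sub>w ?P) vs + (?Q \<and>\<^sub>w ?Q) vs"
    unfolding one wedge_add_left wedge_add_right by simp
  moreover have "(A_two x z c \<and>\<^sub>w A_two x z c) vs = ?k * ?k *
      ((?P \<and>\<^sub>w ?P) vs - (?P \<and>\<^sub>w ?Q) vs - (?Q \<and>\<^sub>w ?P) vs + (?Q \<and>\<^sub>w ?Q) vs)"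
    unfolding two wedge_add_left wedge_add_right wedge_scale_left wedge_scale_right by (simp add: algebra_simps)
  ultimately have "of_int (c\<^sup>2 * \<Delta>) * (A_one x z \<and>\<^sub>w A_one x z) vs - (A_two x z c \<and>\<^sub>w A_two x z c) vs =
      2 * of_int (c\<^sup>2 * \<Delta>) * ((?P \<and>\<^sub>w ?P) vs + cnj ((?P \<and>\<^sub>w ?P) vs))"
    unfolding k QQ by (simp add: algebra_simps)
  also have "\<dots> = 4 * of_int (c\<^sup>2 * \<Delta>) * M_form x z vs"
    unfolding A_plus_square M_form_eq conj_form_def by (simp add: algebra_simps)
  finally show ?thesis .
qed

lemma homogeneous_A_plus: "homogeneous 2 (A_plus x z)"
proof -
  have "homogeneous 2 (e_form z i \<and>\<^sub>w e_form z j)" for i j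
    using homogeneous_wedge[OF homogeneous_e_form homogeneous_e_form, of z i z j]
    by (simp add: numeral_2_eq_2)
  then show ?thesis by (simp add: A_plus_def homogeneous_def)
qed

lemma annihilated_by_A_plus: "annihilated_by {v. \<forall>j\<in>{1..4}. z j v = 0} (A_plus x z)"
proof -
  let ?K = "{v. \<forall>j\<in>{1..4}. z j v = 0}"
  have "annihilated_by ?K (e_form z j)" if "j \<in> {1..4}" for j
    using that
    by (auto simp: annihilated_by_def e_form_def dz_def dzbar_def conj_form_def covector_def split: list.split)
  then have "annihilated_by ?K (e_form z i \<and>\<^sub>w e_form z j)" if "j \<in> {1..4}" "i \<in> {1..<j}" for i j
    using that by (intro annihilated_by_wedge) auto
  then show ?thesis
    unfolding annihilated_by_def A_plus_def by (intro allI impI sum.neutral ballI) auto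
qed

theorem theorem3p2:
  fixes P :: "rat poly" and p0 p1 p2 p4 :: rat
    and x :: "nat \<Rightarrow> real"
    and \<Delta> c :: int
    and F :: "complex set"
    and \<phi> :: "nat \<Rightarrow> complex \<Rightarrow> complex"
    and iota :: "complex \<Rightarrow> 'v::euclidean_space"
    and \<Lambda> :: "'v set"
    and z :: "nat \<Rightarrow> 'v \<Rightarrow> complex"
    and L1 L2 :: "'v vbundle"
  assumes P_def: "P = [:p0, p1, p2, 0, p4:]"
    and P_irred: "irreducible P"
    and x_roots: "\<And>j. j \<in> {1..4} \<Longrightarrow> poly (map_poly of_rat P) (x j) = 0"
    and x_order: "x 1 > x 2" "x 2 > x 3" "x 3 > x 4"
    and galois: "galois_group (adjoin (x ` {1..4})) \<cong> sym_group 4"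
    and disc_int: "(root_disc x)\<^sup>2 = of_int \<Delta>"
    and F_def: "F = adjoin {complex_of_real (x 1), \<i> * complex_of_real (root_disc x)}"
    and phi_hom: "\<And>j. j \<in> {1..4} \<Longrightarrow> field_hom_on F (\<phi> j)"
    and phi_x: "\<And>j. j \<in> {1..4} \<Longrightarrow> \<phi> j (complex_of_real (x 1)) = complex_of_real (x j)"
    and phi_D: "\<And>j. j \<in> {1..4} \<Longrightarrow> \<phi> j (\<i> * complex_of_real (root_disc x)) =
                  (-1) ^ (j + 1) * (\<i> * complex_of_real (root_disc x))"
    and V_def: "real_scalar_extension F iota"
    and Lambda_def: "\<Lambda> = iota ` ring_of_integers F"
    and z_linear: "\<And>j. j \<in> {1..4} \<Longrightarrow> linear (z j)"
    and z_phi: "\<And>j a. j \<in> {1..4} \<Longrightarrow> a \<in> F \<Longrightarrow> z j (iota a) = \<phi> j a"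
    and A1_integral: "integral_class \<Lambda> (A_one x z)"
    and A2_integral: "integral_class \<Lambda> (A_two x z c)"
    and L1: "line_bundle \<Lambda> L1" "has_first_chern_class \<Lambda> L1 (A_one x z)"
    and L2: "line_bundle \<Lambda> L2" "has_first_chern_class \<Lambda> L2 (A_two x z c)"
  shows "\<exists>\<beta> \<gamma>. rational_class \<Lambda> \<beta> \<and> homogeneous 0 \<beta> \<and> rational_class \<Lambda> \<gamma> \<and> homogeneous 8 \<gamma> \<and>
    has_chern_character_diff \<Lambda>
      (sum_power (nat (c\<^sup>2 * \<Delta>)) (direct_sum L1 (dual_bundle L1)))
      (direct_sum L2 (dual_bundle L2))
      (\<lambda>vs. 4 * of_int (c\<^sup>2 * \<Delta>) * M_form x z vs + \<beta> vs + \<gamma> vs)"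
proof -
  define n where "n = nat (c\<^sup>2 * \<Delta>)"
  have "0 \<le> \<Delta>" using disc_int zero_le_power2[of "root_disc x"] by linarith
  then have n: "of_nat n = (of_int (c\<^sup>2 * \<Delta>) :: complex)"
    by (simp add: n_def)
  let ?\<alpha>1 = "A_one x z" and ?\<alpha>2 = "A_two x z c"
  let ?ch = "\<lambda>\<alpha> vs. 2 * unit_form vs + (\<alpha> \<and>\<^sub>w \<alpha>) vs + wedge_power \<alpha> 4 vs / 12 :: complex"
  \<comment> \<open>All forms in question factor through these eight real coordinates.\<close>
  define g where "g v = (z 1 v, z 2 v, z 3 v, z 4 v)" for v
  have g: "linear g"
  proof -
    have "linear (z 1)" "linear (z 2)" "linear (z 3)" "linear (z 4)"
      using z_linear by auto
    then show ?thesis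
      by (intro linearI) (simp_all add: g_def linear_add linear_scale)
  qed
  have dim: "DIM(complex \<times> complex \<times> complex \<times> complex) = 8" by simp
  have kernel: "{v. g v = 0} = {v. \<forall>j\<in>{1..4}. z j v = 0}"
  proof -
    have "{1..4} = {1, 2, 3, 4::nat}" by auto
    then show ?thesis by (simp add: g_def zero_prod_def)
  qed
  have hom: "homogeneous 2 ?\<alpha>1" "homogeneous 2 ?\<alpha>2"
    using homogeneous_A_plus[of x z]
    by (simp_all add: homogeneous_def A_one_def A_two_def conj_form_def)
  have ann: "annihilated_by {v. g v = 0} ?\<alpha>1" "annihilated_by {v. g v = 0} ?\<alpha>2"
    using annihilated_by_A_plus[of z x] unfolding kernel
    by (simp_all add: annihilated_by_def A_one_def A_two_def conj_form_def)
  have ext: "ext_form ?\<alpha>1" "ext_form ?\<alpha>2"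
    using A1_integral A2_integral by (simp_all add: integral_class_def)
  have ext_ch: "ext_form (?ch \<alpha>)" if "ext_form \<alpha>" for \<alpha> :: "'v form"
  proof -
    have "ext_form (\<lambda>vs. 2 * unit_form vs + (\<alpha> \<and>\<^sub>w \<alpha>) vs + 1 / 12 * wedge_power \<alpha> 4 vs)"
      using that by (intro ext_form_add ext_form_scale ext_form_unit_form ext_form_wedge ext_form_wedge_power)
    then show ?thesis by simp
  qed
  let ?V1 = "direct_sum L1 (dual_bundle L1)" and ?V2 = "direct_sum L2 (dual_bundle L2)"
  have V1: "invariant_chern_character \<Lambda> (sum_power n ?V1) (\<lambda>vs. of_nat n * ?ch ?\<alpha>1 vs)"
    by (intro invariant_chern_character_sum_power
      invariant_chern_character_line_plus_dual[OF L1 ext(1) hom(1) g dim ann(1)])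
  have V2: "invariant_chern_character \<Lambda> ?V2 (?ch ?\<alpha>2)"
    by (rule invariant_chern_character_line_plus_dual[OF L2 ext(2) hom(2) g dim ann(2)])
  define \<beta> :: "'v form" where "\<beta> vs = (2 * of_nat n - 2) * unit_form vs" for vs
  define \<gamma> :: "'v form" where
    "\<gamma> vs = of_nat n / 12 * wedge_power ?\<alpha>1 4 vs + - 1 / 12 * wedge_power ?\<alpha>2 4 vs" for vs
  have "rational_class \<Lambda> \<beta>"
    unfolding rational_class_def \<beta>_def
    by (auto intro!: ext_form_scale ext_form_unit_form) (simp add: unit_form_def)
  moreover have "homogeneous 0 \<beta>"
    by (simp add: homogeneous_def \<beta>_def unit_form_def)
  moreover have "rational_class \<Lambda> \<gamma>"
  proof -
    have "wedge_power ?\<alpha>1 4 vs \<in> \<rat>" "wedge_power ?\<alpha>2 4 vs \<in> \<rat>" if "set vs \<subseteq> \<Lambda>" for vs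
      using integral_class_wedge_power[OF A1_integral, of 4] integral_class_wedge_power[OF A2_integral, of 4]
        that Ints_subset_Rats unfolding integral_class_def by blast+
    moreover have "ext_form \<gamma>"
      unfolding \<gamma>_def by (intro ext_form_add ext_form_scale ext_form_wedge_power ext)
    ultimately show ?thesis by (simp add: rational_class_def \<gamma>_def)
  qed
  moreover have "homogeneous 8 \<gamma>"
    using homogeneous_wedge_power[OF hom(1), of 4] homogeneous_wedge_power[OF hom(2), of 4]
    by (simp add: homogeneous_def \<gamma>_def)
  moreover have "has_chern_character_diff \<Lambda> (sum_power n ?V1) ?V2
      (\<lambda>vs. 4 * of_int (c\<^sup>2 * \<Delta>) * M_form x z vs + \<beta> vs + \<gamma> vs)"
    unfolding has_chern_character_diff_def
  proof (intro conjI exI allI)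
    show "vector_bundle \<Lambda> (sum_power n ?V1)" "vector_bundle \<Lambda> ?V2"
      using V1 V2 by (simp_all add: invariant_chern_character_def)
    show "has_chern_character \<Lambda> (sum_power n ?V1) (\<lambda>vs. of_nat n * ?ch ?\<alpha>1 vs)"
      by (intro has_chern_character_invariant V1 ext_form_scale ext_ch ext)
    show "has_chern_character \<Lambda> ?V2 (?ch ?\<alpha>2)"
      by (intro has_chern_character_invariant V2 ext_ch ext)
    show "4 * of_int (c\<^sup>2 * \<Delta>) * M_form x z vs + \<beta> vs + \<gamma> vs = of_nat n * ?ch ?\<alpha>1 vs - ?ch ?\<alpha>2 vs" for vs
      using A_squares_difference[OF disc_int, of c z vs, folded n]
      unfolding \<beta>_def \<gamma>_def n[symmetric] by (simp add: algebra_simps)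
  qed
  ultimately show ?thesis unfolding n_def by blast
qed

end
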